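(* Let $P_1(x,y)$ and $P_2(x,y)$ be homogeneous quadratic polynomials with integer coefficients such that $\operatorname{Disc}(P_1)\neq 0$, $\operatorname{Disc}(P_2)\neq 0$, and $\operatorname{Res}(P_1,P_2)\neq 0$. Then the equation $$z^2=\frac{P_1(x,y)}{P_2(x,y)}$$ has a finite number of integer solutions $(x,y,z)=(m,n,k)$ with $\gcd(m,n)=1$.
   Context: For a homogeneous quadratic polynomial $P(x,y)=ax^2+bxy+cy^2$, $\operatorname{Disc}(P)=b^2-4ac$. For $P_i(x,y)=a_ix^2+b_ixy+c_iy^2$ ($i=1,2$), $\operatorname{Res}(P_1,P_2)$ is the determinant of the $4\times4$ matrix $$\begin{bmatrix} a_1 & 0 & a_2 & 0\\ b_1 & a_1 & b_2 & a_2\\ c_1 & b_1 & c_2 & b_2\\ 0 & c_1 & 0 & c_2\end{bmatrix}.$$ A solution $(m,n,k)$ is understood to satisfy $P_2(m,n)\neq 0$. *)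

theory Defs
  imports "HOL-Analysis.Determinants"
begin

text \<open>
  A homogeneous quadratic polynomial \<open>a x\<^sup>2 + b x y + c y\<^sup>2\<close> with integer coefficients is
  represented by its coefficients. All of them are allowed to be zero.
\<close>

datatype quad_form = Quad_Form (coeff_xx: int) (coeff_xy: int) (coeff_yy: int)

definition eval_form :: "quad_form \<Rightarrow> int \<Rightarrow> int \<Rightarrow> int" where
  "eval_form P x y = coeff_xx P * x\<^sup>2 + coeff_xy P * x * y + coeff_yy P * y\<^sup>2"

definition Disc :: "quad_form \<Rightarrow> int" where
  "Disc P = (coeff_xy P)\<^sup>2 - 4 * coeff_xx P * coeff_yy P"

text \<open>
  The inner lists are the rows. The indices \<open>1, 2, 3, 4\<close> of type \<open>4\<close> are taken modulo \<open>4\<close>,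
  so the last row and column carry the index \<open>0\<close>.
\<close>

definition Res_matrix :: "quad_form \<Rightarrow> quad_form \<Rightarrow> int^4^4" where
  "Res_matrix P\<^sub>1 P\<^sub>2 = vector
    [vector [coeff_xx P\<^sub>1, 0,           coeff_xx P\<^sub>2, 0          ],
     vector [coeff_xy P\<^sub>1, coeff_xx P\<^sub>1, coeff_xy P\<^sub>2, coeff_xx P\<^sub>2],
     vector [coeff_yy P\<^sub>1, coeff_xy P\<^sub>1, coeff_yy P\<^sub>2, coeff_xy P\<^sub>2],
     vector [0,           coeff_yy P\<^sub>1, 0,           coeff_yy P\<^sub>2]]"

definition Res :: "quad_form \<Rightarrow> quad_form \<Rightarrow> int" where
  "Res P\<^sub>1 P\<^sub>2 = det (Res_matrix P\<^sub>1 P\<^sub>2)"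

end

theory Submission
  imports Defs "HOL-Analysis.Elementary_Metric_Spaces" "HOL-Computational_Algebra.Polynomial"
begin

text \<open>
Write \<open>d = P\<^sub>2(m, n)\<close>. If \<open>m\<close> and \<open>n\<close> are coprime and \<open>P\<^sub>1(m, n) = d z\<^sup>2\<close>, then \<open>d\<close> divides both
values, hence the resultant, so only finitely many \<open>d\<close> occur and each can be treated on its own
(\<open>common_divisor_dvd_Res\<close>).

For a fixed \<open>d\<close> and one solution \<open>(m\<^sub>0, n\<^sub>0, z\<^sub>0)\<close> with \<open>z\<^sub>0 \<noteq> 0\<close>, the conic \<open>P\<^sub>1(x, y) = d z\<^sup>2\<close> is
parametrized by the lines through this point: \<open>(x : y) = (X(a, b) : Y(a, b))\<close> for two binary
quadratic forms \<open>X\<close>, \<open>Y\<close>. If \<open>a\<close>, \<open>b\<close> are coprime, the common factor \<open>t\<close> of \<open>X(a, b)\<close> and \<open>Y(a, b)\<close>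
divides the resultant of \<open>X\<close> and \<open>Y\<close>, which is not zero. The condition \<open>P\<^sub>2(m, n) = d\<close> therefore
becomes one of finitely many equations \<open>P\<^sub>2(X(a, b), Y(a, b)) = t\<^sup>2 d\<close> with a binary quartic form
on the left. By the hypotheses on the discriminants and the resultant, this quartic has only simple
real roots (\<open>quartic_poly_simple_roots\<close>), so the methods for Thue equations apply.

A solution \<open>(a, b)\<close> of a quartic Thue equation with \<open>\<bar>a\<bar> \<le> \<bar>b\<bar>\<close> and \<open>b\<close> large gives a root \<open>\<theta>\<close> of the quartic with
\<open>\<bar>\<theta> - a / b\<bar> \<le> c / b\<^sup>4\<close>. There are only finitely many such fractions: for a root of degree at most
\<open>3\<close> by Liouville's inequality, and for a root of degree \<open>4\<close> by Thue's theorem, whose exponent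
\<open>4 / 2 + 1\<close> is smaller than \<open>4\<close> (\<open>finite_approximations_quartic\<close>).

Thue's argument runs as follows. The pigeonhole principle gives integer polynomials \<open>P\<close>, \<open>Q\<close> of degree
at most \<open>8 k\<close> with coefficients at most \<open>C\<^sup>k\<close> such that \<open>P - \<theta> Q\<close> vanishes at \<open>\<theta>\<close> to order \<open>3 k\<close>
(\<open>auxiliary_polynomials\<close>). If \<open>p\<^sub>0 / q\<^sub>0\<close> and \<open>p\<^sub>1 / q\<^sub>1\<close> are both very close to \<open>\<theta>\<close>, then
\<open>F = q\<^sub>1 P - p\<^sub>1 Q\<close> is very small near \<open>p\<^sub>0 / q\<^sub>0\<close>. On the other hand some Taylor coefficient of \<open>F\<close> at
\<open>p\<^sub>0 / q\<^sub>0\<close>, of an index controlled by the Wronskian of \<open>P\<close> and \<open>Q\<close> and by Gauss's lemma, is a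
nonzero rational number with denominator at most \<open>q\<^sub>0\<close> to the power \<open>8 k\<close>. This is contradictory when
\<open>q\<^sub>0\<close> is large, \<open>q\<^sub>1\<close> is much larger, and \<open>k\<close> is about \<open>log q\<^sub>1 / (3 log q\<^sub>0)\<close>.
\<close>

section \<open>Real polynomials with integer coefficients\<close>

text \<open>
Integer polynomials are kept inside \<^typ>\<open>real poly\<close>, since they are constantly combined with
\<open>\<theta>\<close> and divided by real linear factors.
\<close>

definition int_coeffs :: "real poly \<Rightarrow> bool" where
  "int_coeffs p \<longleftrightarrow> (\<forall>i. coeff p i \<in> \<int>)"

lemma int_coeffs_mult: "int_coeffs p \<Longrightarrow> int_coeffs q \<Longrightarrow> int_coeffs (p * q)"
  by (auto simp: int_coeffs_def coeff_mult)

lemma int_coeffs_add: "int_coeffs p \<Longrightarrow> int_coeffs q \<Longrightarrow> int_coeffs (p + q)"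
  by (auto simp: int_coeffs_def)

lemma int_coeffs_diff: "int_coeffs p \<Longrightarrow> int_coeffs q \<Longrightarrow> int_coeffs (p - q)"
  by (auto simp: int_coeffs_def)

lemma int_coeffs_smult: "c \<in> \<int> \<Longrightarrow> int_coeffs p \<Longrightarrow> int_coeffs (smult c p)"
  by (auto simp: int_coeffs_def)

lemma int_coeffs_monom: "c \<in> \<int> \<Longrightarrow> int_coeffs (monom c n)"
  by (auto simp: int_coeffs_def)

lemma int_coeffs_pderiv: "int_coeffs p \<Longrightarrow> int_coeffs (pderiv p)"
  unfolding int_coeffs_def coeff_pderiv by (blast intro: Ints_mult Ints_of_nat)

lemma int_coeffs_pCons: "int_coeffs (pCons a p) \<longleftrightarrow> a \<in> \<int> \<and> int_coeffs p"
  unfolding int_coeffs_def by (metis coeff_pCons_0 coeff_pCons_Suc old.nat.exhaust)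

lemma degree_diff_less_lead:
  fixes p q :: "real poly"
  assumes "degree p = degree q" "lead_coeff p = lead_coeff q" "degree p > 0"
  shows "degree (p - q) < degree p"
proof (cases "p - q = 0")
  case False
  have "degree (p - q) \<le> degree p" using assms degree_diff_le[of p "degree p" q] by simp
  moreover have "coeff (p - q) (degree p) = 0" using assms by simp
  ultimately show ?thesis using False by (metis leading_coeff_0_iff le_neq_implies_less)
qed (use assms in simp)

text \<open>
This is the instance of Gauss's lemma for a primitive linear factor. Clearing denominators in
\<open>W(p / q) = 0\<close> shows that \<open>q\<close> divides the leading coefficient of \<open>W\<close>, so the top term can be
removed by an integral multiple of \<open>q x - p\<close>, and the degree drops.
\<close>

lemma rational_root_factor:
  assumes "int_coeffs W" and "poly W (of_int p / of_int q) = 0" and "coprime p q" and "q > 0"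
  shows "\<exists>V. int_coeffs V \<and> W = [:- of_int p, of_int q:] * V"
  using assms
proof (induction "degree W" arbitrary: W rule: less_induct)
  case less
  show ?case
  proof (cases "degree W = 0")
    case True
    then obtain c where "W = [:c:]" by (metis degree_eq_zeroE)
    then show ?thesis using less by (intro exI[of _ 0]) (simp add: int_coeffs_def)
  next
    case False
    define n where "n = degree W - 1"
    have n: "degree W = Suc n" using False by (simp add: n_def)
    have "\<forall>i. \<exists>c::int. coeff W i = of_int c"
      using less.prems(1) by (auto simp: int_coeffs_def elim: Ints_cases)
    then obtain w :: "nat \<Rightarrow> int" where w: "\<And>i. coeff W i = of_int (w i)" by metis
    have "0 = of_int q ^ Suc n * poly W (of_int p / of_int q)" using less.prems by simp
    also have "\<dots> = (\<Sum>i\<le>Suc n. of_int (w i * p ^ i * q ^ (Suc n - i)))"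
      unfolding poly_altdef n sum_distrib_left
    proof (intro sum.cong refl)
      fix i assume "i \<in> {..Suc n}"
      then have "real_of_int q ^ Suc n = of_int q ^ (Suc n - i) * of_int q ^ i"
        by (simp del: power_Suc flip: power_add)
      then show "of_int q ^ Suc n * (coeff W i * (of_int p / of_int q) ^ i)
          = real_of_int (w i * p ^ i * q ^ (Suc n - i))"
        using less.prems(4) by (simp add: w power_divide del: power_Suc)
    qed
    finally have "of_int (\<Sum>i\<le>Suc n. w i * p ^ i * q ^ (Suc n - i)) = (0::real)" by simp
    then have "(\<Sum>i\<le>Suc n. w i * p ^ i * q ^ (Suc n - i)) = 0" by linarith
    then have "w (Suc n) * p ^ Suc n = - (\<Sum>i\<le>n. w i * p ^ i * q ^ (Suc n - i))"
      by simp
    moreover have "q dvd (\<Sum>i\<le>n. w i * p ^ i * q ^ (Suc n - i))"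
      by (intro dvd_sum) (auto simp: Suc_diff_le)
    ultimately have "q dvd w (Suc n) * p ^ Suc n" by simp
    moreover have "coprime q (p ^ Suc n)"
      using less.prems(3) by (simp add: coprime_commute del: power_Suc)
    ultimately have "q dvd w (Suc n)" by (simp add: coprime_dvd_mult_left_iff del: power_Suc)
    then obtain v where v: "w (Suc n) = q * v" by (elim dvdE)
    have v0: "v \<noteq> 0"
    proof
      assume "v = 0"
      then have "lead_coeff W = 0" using v w[of "Suc n"] n by simp
      then show False using False leading_coeff_0_iff[of W] by simp
    qed
    define l where "l = [:- real_of_int p, of_int q:]"
    have il: "int_coeffs l" by (simp add: l_def int_coeffs_pCons) (simp add: int_coeffs_def)
    define M where "M = l * monom (of_int v) n"
    have iM: "int_coeffs M" unfolding M_def by (intro int_coeffs_mult il int_coeffs_monom) simp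
    have dl: "degree l = 1" using less.prems(4) by (simp add: l_def)
    have dM: "degree M = Suc n"
      unfolding M_def using v0 dl by (subst degree_mult_eq) (auto simp: degree_monom_eq)
    have lM: "lead_coeff M = of_int (w (Suc n))"
      unfolding M_def lead_coeff_mult using v0 v less.prems(4) by (simp add: degree_monom_eq l_def)
    have "degree (W - M) < degree W"
      by (intro degree_diff_less_lead) (use dM lM n w in auto)
    moreover have "poly (W - M) (of_int p / of_int q) = 0"
      using less.prems by (simp add: M_def l_def)
    moreover have "int_coeffs (W - M)" by (intro int_coeffs_diff less.prems iM)
    ultimately have "\<exists>V. int_coeffs V \<and> W - M = l * V"
      unfolding l_def using less.prems(3,4) by (intro less.hyps)
    then obtain V where V: "int_coeffs V" "W - M = l * V" by blast
    have "W = l * (V + monom (of_int v) n)"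
      using V(2) unfolding M_def by (simp add: algebra_simps)
    moreover have "int_coeffs (V + monom (of_int v) n)"
      by (intro int_coeffs_add int_coeffs_monom V(1)) simp
    ultimately show ?thesis unfolding l_def by (intro exI conjI)
  qed
qed

text \<open>
An integer polynomial of small size cannot vanish to high order at a fraction with large
denominator: every factor \<open>q x - p\<close> contributes a factor \<open>q\<close> to the leading coefficient.
\<close>

lemma denominator_power_le_lead_coeff:
  assumes "int_coeffs W" and "W \<noteq> 0" and "coprime p q" and "q > 0"
    and "[:- (of_int p / of_int q), 1:] ^ j dvd W"
  shows "of_int q ^ j \<le> \<bar>lead_coeff W\<bar>"
  using assms
proof (induction j arbitrary: W)
  case 0
  then show ?case using Ints_nonzero_abs_ge1[of "lead_coeff W"] by (simp add: int_coeffs_def)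
next
  case (Suc j)
  define x :: real where "x = of_int p / of_int q"
  have "[:- x, 1:] dvd W" using Suc.prems(5) unfolding x_def power_Suc by (rule dvd_mult_left)
  then have "poly W x = 0" by (simp add: poly_eq_0_iff_dvd)
  then obtain V where V: "int_coeffs V" "W = [:- of_int p, of_int q:] * V"
    using rational_root_factor Suc.prems unfolding x_def by blast
  have eq: "[:- of_int p, of_int q:] = smult (of_int q) [:- x, 1:]"
    using Suc.prems(4) by (simp add: x_def)
  have "[:- x, 1:] * [:- x, 1:] ^ j dvd [:- x, 1:] * smult (of_int q) V"
    using Suc.prems(5) unfolding V(2) x_def[symmetric] eq power_Suc mult_smult_left mult_smult_right .
  then have "[:- x, 1:] ^ j dvd smult (of_int q) V"
    by (subst (asm) dvd_mult_cancel_left) simp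
  then have "[:- x, 1:] ^ j dvd V" using Suc.prems(4) by (simp add: dvd_smult_iff)
  then have "of_int q ^ j \<le> \<bar>lead_coeff V\<bar>"
    using Suc.IH[of V] V Suc.prems unfolding x_def by fastforce
  moreover have "lead_coeff W = of_int q * lead_coeff V"
    unfolding V(2) lead_coeff_mult using Suc.prems(4) by simp
  ultimately show ?case using Suc.prems(4) by (simp add: abs_mult)
qed

section \<open>Length and Taylor shift of a polynomial\<close>

text \<open>
The length (sum of the absolute values of the coefficients) is submultiplicative, which makes it
more convenient than the maximum of the coefficients.
\<close>

definition poly_length :: "real poly \<Rightarrow> real" where
  "poly_length p = sum_list (map abs (coeffs p))"

lemma poly_length_0 [simp]: "poly_length 0 = 0"
  by (simp add: poly_length_def)

lemma poly_length_pCons [simp]: "poly_length (pCons a p) = \<bar>a\<bar> + poly_length p"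
  by (auto simp: poly_length_def cCons_def)

lemma poly_length_nonneg [simp]: "0 \<le> poly_length p"
  by (induction p) auto

lemma poly_length_add: "poly_length (p + q) \<le> poly_length p + poly_length q"
  by (induction p q rule: poly_induct2) auto

lemma poly_length_smult [simp]: "poly_length (smult c p) = \<bar>c\<bar> * poly_length p"
  by (induction p) (auto simp: abs_mult algebra_simps)

lemma poly_length_diff: "poly_length (p - q) \<le> poly_length p + poly_length q"
  using poly_length_add[of p "- q"] poly_length_smult[of "-1" q] by simp

lemma poly_length_mult: "poly_length (p * q) \<le> poly_length p * poly_length q"
proof (induction p)
  case (pCons a p)
  have "poly_length (pCons a p * q) \<le> \<bar>a\<bar> * poly_length q + poly_length (p * q)"
    using poly_length_add[of "smult a q" "pCons 0 (p * q)"] by simp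
  then show ?case using pCons.IH by (simp add: algebra_simps)
qed simp

lemma abs_coeff_le_poly_length: "\<bar>coeff p i\<bar> \<le> poly_length p"
proof (induction p arbitrary: i)
  case (pCons a p)
  show ?case
  proof (cases i)
    case (Suc j)
    then show ?thesis using pCons.IH[of j] by simp
  qed simp
qed simp

lemma poly_length_altdef: "degree p \<le> n \<Longrightarrow> poly_length p = (\<Sum>i\<le>n. \<bar>coeff p i\<bar>)"
proof (induction p arbitrary: n)
  case (pCons a p)
  show ?case
  proof (cases n)
    case 0
    then have "p = 0" using pCons.prems by (metis degree_pCons_eq le_zero_eq nat.distinct(1))
    then show ?thesis using 0 by simp
  next
    case (Suc m)
    then have "degree p \<le> m" using pCons.prems by (cases "p = 0") auto
    then show ?thesis using pCons.IH[of m] Suc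
      by (simp add: sum.atMost_Suc_shift del: sum.atMost_Suc)
  qed
qed simp

lemma poly_length_pcompose:
  assumes "poly_length q \<le> K" and "1 \<le> K" and "degree p \<le> n"
  shows "poly_length (p \<circ>\<^sub>p q) \<le> poly_length p * K ^ n"
  using assms(3)
proof (induction p arbitrary: n)
  case (pCons a p)
  show ?case
  proof (cases n)
    case 0
    then have "p = 0" using pCons.prems by (metis degree_pCons_eq le_zero_eq nat.distinct(1))
    then show ?thesis using 0 by simp
  next
    case (Suc m)
    then have "degree p \<le> m" using pCons.prems by (cases "p = 0") auto
    have "poly_length (pCons a p \<circ>\<^sub>p q) \<le> \<bar>a\<bar> + poly_length q * poly_length (p \<circ>\<^sub>p q)"
      using poly_length_add[of "[:a:]" "q * p \<circ>\<^sub>p q"] poly_length_mult[of q "p \<circ>\<^sub>p q"]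
      by (simp add: pcompose_pCons)
    also have "\<dots> \<le> \<bar>a\<bar> * K ^ n + K * (poly_length p * K ^ m)"
    proof (intro add_mono mult_mono pCons.IH assms(1) \<open>degree p \<le> m\<close>)
      show "\<bar>a\<bar> \<le> \<bar>a\<bar> * K ^ n" using assms(2) by (simp add: mult_le_cancel_left1 one_le_power)
    qed (use assms in auto)
    also have "\<dots> = poly_length (pCons a p) * K ^ n" by (simp add: Suc algebra_simps)
    finally show ?thesis .
  qed
qed simp

lemma poly_length_pderiv:
  assumes "degree p \<le> n"
  shows "poly_length (pderiv p) \<le> n * poly_length p"
proof -
  have "poly_length (pderiv p) = (\<Sum>i\<le>n. \<bar>coeff (pderiv p) i\<bar>)"
    using assms by (intro poly_length_altdef) (simp add: degree_pderiv)
  also have "\<dots> \<le> (\<Sum>i\<le>n. n * \<bar>coeff p (Suc i)\<bar>)"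
  proof (intro sum_mono)
    fix i
    show "\<bar>coeff (pderiv p) i\<bar> \<le> n * \<bar>coeff p (Suc i)\<bar>"
    proof (cases "Suc i \<le> n")
      case True
      then show ?thesis by (simp only: coeff_pderiv abs_mult abs_of_nat) (intro mult_right_mono, auto)
    next
      case False
      then show ?thesis using assms by (simp add: coeff_pderiv coeff_eq_0)
    qed
  qed
  also have "\<dots> = n * (\<Sum>i\<le>n. \<bar>coeff p (Suc i)\<bar>)" by (simp add: sum_distrib_left)
  also have "(\<Sum>i\<le>n. \<bar>coeff p (Suc i)\<bar>) \<le> (\<Sum>i\<le>Suc n. \<bar>coeff p i\<bar>)"
    by (subst sum.atMost_Suc_shift) simp
  also have "\<dots> = poly_length p" using assms by (intro poly_length_altdef[symmetric]) simp
  finally show ?thesis by (simp add: mult_left_mono)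
qed

lemma pcompose_power: "(p ^ n) \<circ>\<^sub>p q = (p \<circ>\<^sub>p q :: real poly) ^ n"
  by (induction n) (simp_all add: pcompose_mult pcompose_1)

text \<open>
The coefficients of \<open>p(x + y)\<close> as a polynomial in \<open>y\<close> are the derivatives of \<open>p\<close> at \<open>x\<close> divided by
factorials. Without this division the factorials would spoil the bounds of the form \<open>C\<^sup>k\<close>.
\<close>

lemma coeff_shift_eq_0_iff:
  "(\<forall>i<m. coeff (p \<circ>\<^sub>p [:x, 1:]) i = 0) \<longleftrightarrow> [:- x, 1:] ^ m dvd (p::real poly)"
proof
  have shift: "[:x, 1:] \<circ>\<^sub>p [:- x, 1:] = [:0, 1:]" "[:0, 1:] \<circ>\<^sub>p [:- x, 1:] = [:- x, 1:]"
    by (simp_all add: pcompose_pCons)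
  assume "\<forall>i<m. coeff (p \<circ>\<^sub>p [:x, 1:]) i = 0"
  then have "monom 1 m dvd p \<circ>\<^sub>p [:x, 1:]" by (simp add: monom_1_dvd_iff')
  then obtain s where s: "p \<circ>\<^sub>p [:x, 1:] = [:0, 1:] ^ m * s"
    unfolding monom_altdef by auto
  have "p = p \<circ>\<^sub>p [:x, 1:] \<circ>\<^sub>p [:- x, 1:]"
    by (simp only: pcompose_assoc[symmetric] shift pcompose_idR)
  also have "\<dots> = [:- x, 1:] ^ m * s \<circ>\<^sub>p [:- x, 1:]"
    by (simp only: s pcompose_mult pcompose_power shift)
  finally show "[:- x, 1:] ^ m dvd p" by (metis dvd_triv_left)
next
  assume "[:- x, 1:] ^ m dvd p"
  then obtain s where s: "p = [:- x, 1:] ^ m * s" ..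
  have "[:- x, 1:] \<circ>\<^sub>p [:x, 1:] = [:0, 1:]" by (simp add: pcompose_pCons)
  then have "p \<circ>\<^sub>p [:x, 1:] = monom 1 m * s \<circ>\<^sub>p [:x, 1:]"
    by (simp only: s pcompose_mult pcompose_power monom_altdef smult_1_left)
  then have "monom 1 m dvd p \<circ>\<^sub>p [:x, 1:]" by simp
  then show "\<forall>i<m. coeff (p \<circ>\<^sub>p [:x, 1:]) i = 0" by (simp add: monom_1_dvd_iff')
qed

section \<open>Auxiliary polynomials\<close>

text \<open>
Siegel's lemma: a linear system with fewer equations than unknowns has a small integer solution.
The vectors with entries in \<open>{0..B}\<close> outnumber their possible images, so two of them have the same
image, and their difference is a solution.
\<close>

lemma bounded_integer_kernel_vector:
  fixes a :: "'r \<Rightarrow> 'i \<Rightarrow> int" and A B :: nat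
  assumes fin: "finite R" "finite I"
    and a: "\<And>r i. r \<in> R \<Longrightarrow> i \<in> I \<Longrightarrow> \<bar>a r i\<bar> \<le> int A"
    and many: "(card I * A * B + 1) ^ card R < (B + 1) ^ card I"
  shows "\<exists>x. (\<exists>i\<in>I. x i \<noteq> 0) \<and> (\<forall>i\<in>I. \<bar>x i\<bar> \<le> int B) \<and> (\<forall>r\<in>R. (\<Sum>i\<in>I. a r i * x i) = 0)"
proof -
  define X where "X = (\<Pi>\<^sub>E i\<in>I. {0..int B})"
  define neg pos where "neg r = (\<Sum>i\<in>I. max 0 (- a r i))" and "pos r = (\<Sum>i\<in>I. max 0 (a r i))" for r
  define Y where "Y = (\<Pi>\<^sub>E r\<in>R. {- neg r * int B..pos r * int B})"
  define f where "f x = (\<lambda>r\<in>R. \<Sum>i\<in>I. a r i * x i)" for x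
  have f: "f x \<in> Y" if "x \<in> X" for x
  proof -
    have "- neg r * int B \<le> (\<Sum>i\<in>I. a r i * x i) \<and> (\<Sum>i\<in>I. a r i * x i) \<le> pos r * int B" for r
      unfolding neg_def pos_def sum_distrib_right sum_negf[symmetric]
    proof (intro conjI sum_mono)
      fix i assume i: "i \<in> I"
      then have x: "0 \<le> x i" "x i \<le> int B" using that by (auto simp: X_def)
      have "max 0 (- a r i) * x i \<le> max 0 (- a r i) * int B" using x by (intro mult_left_mono) auto
      moreover have "- a r i * x i \<le> max 0 (- a r i) * x i" using x by (intro mult_right_mono) auto
      ultimately show "- max 0 (- a r i) * int B \<le> a r i * x i" by simp
      have "max 0 (a r i) * x i \<le> max 0 (a r i) * int B" using x by (intro mult_left_mono) auto
      moreover have "a r i * x i \<le> max 0 (a r i) * x i" using x by (intro mult_right_mono) auto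
      ultimately show "a r i * x i \<le> max 0 (a r i) * int B" by simp
    qed
    then show ?thesis by (simp add: Y_def f_def)
  qed
  have "card Y = (\<Prod>r\<in>R. card {- neg r * int B..pos r * int B})"
    unfolding Y_def by (rule card_PiE) (rule fin)
  also have "\<dots> \<le> (\<Prod>r\<in>R. card I * A * B + 1)"
  proof (intro prod_mono conjI)
    fix r assume r: "r \<in> R"
    have "neg r + pos r = (\<Sum>i\<in>I. \<bar>a r i\<bar>)"
      unfolding neg_def pos_def sum.distrib[symmetric] by (intro sum.cong) auto
    also have "\<dots> \<le> int (card I * A)" using sum_bounded_above[of I "\<lambda>i. \<bar>a r i\<bar>" "int A"] a r by simp
    finally have "(neg r + pos r) * int B \<le> int (card I * A) * int B" by (intro mult_right_mono) auto
    then show "card {- neg r * int B..pos r * int B} \<le> card I * A * B + 1"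
      by (simp add: nat_le_iff algebra_simps)
  qed simp
  also have "\<dots> < (B + 1) ^ card I" using many by simp
  also have "(B + 1) ^ card I = card X" unfolding X_def using fin by (simp add: card_PiE nat_add_distrib)
  finally have "card Y < card X" .
  moreover have "finite Y" unfolding Y_def using fin by (intro finite_PiE) auto
  ultimately have "\<not> inj_on f X" using card_inj_on_le[of f X Y] f by (auto simp: image_subset_iff)
  then obtain x y where xy: "x \<in> X" "y \<in> X" "x \<noteq> y" "f x = f y" by (auto simp: inj_on_def)
  have "\<exists>i\<in>I. x i - y i \<noteq> 0"
  proof (rule ccontr)
    assume "\<not> (\<exists>i\<in>I. x i - y i \<noteq> 0)"
    then have "x i = y i" if "i \<in> I" for i using that by simp
    then have "x = y" by (rule PiE_ext[OF xy(1,2)[unfolded X_def]])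
    then show False using xy by simp
  qed
  moreover have "\<bar>x i - y i\<bar> \<le> int B" if "i \<in> I" for i
  proof -
    have "x i \<in> {0..int B}" "y i \<in> {0..int B}" using xy(1,2) that by (auto simp: X_def)
    then show ?thesis by auto
  qed
  moreover have "(\<Sum>i\<in>I. a r i * (x i - y i)) = 0" if "r \<in> R" for r
    using fun_cong[OF xy(4), of r] that by (simp add: f_def right_diff_distrib sum_subtractf)
  ultimately show ?thesis by (intro exI[of _ "\<lambda>i. x i - y i"] conjI ballI)
qed

text \<open>
If \<open>g\<close> has leading coefficient \<open>l\<close> and root \<open>\<theta>\<close>, then \<open>l \<theta>\<close> to the power \<open>e\<close> is an integral
combination of the powers of \<open>\<theta>\<close> below the degree of \<open>g\<close>, with coefficients that grow only
exponentially in \<open>e\<close>. This turns one equation over \<open>\<int>[\<theta>]\<close> into integer equations of controlled size.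
\<close>

lemma powers_of_root_reduced:
  fixes g :: "nat \<Rightarrow> int" and \<theta> :: real and H :: nat
  assumes root: "(\<Sum>i\<le>Suc d. of_int (g i) * \<theta> ^ i) = 0" and H: "\<And>i. i \<le> Suc d \<Longrightarrow> \<bar>g i\<bar> \<le> int H"
  shows "\<exists>c :: nat \<Rightarrow> int. of_int (g (Suc d)) ^ e * \<theta> ^ e = (\<Sum>l\<le>d. of_int (c l) * \<theta> ^ l)
           \<and> (\<forall>l\<le>d. \<bar>c l\<bar> \<le> int ((2 * H) ^ e))"
proof (induction e)
  case 0
  have "(\<Sum>l\<le>d. real_of_int (if l = 0 then 1 else 0) * \<theta> ^ l) = 1"
    by (simp add: if_distrib[of real_of_int] if_distrib[of "\<lambda>x. x * _"] cong: if_cong)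
  then show ?case by (intro exI[of _ "\<lambda>l. if l = 0 then 1 else 0"]) simp
next
  case (Suc e)
  then obtain c where c: "of_int (g (Suc d)) ^ e * \<theta> ^ e = (\<Sum>l\<le>d. of_int (c l) * \<theta> ^ l)"
    and cb: "\<And>l. l \<le> d \<Longrightarrow> \<bar>c l\<bar> \<le> int ((2 * H) ^ e)" by blast
  define c' where "c' l = (if l = 0 then 0 else g (Suc d) * c (l - 1)) - c d * g l" for l
  have top: "of_int (g (Suc d)) * \<theta> ^ Suc d = - (\<Sum>l\<le>d. of_int (g l) * \<theta> ^ l)"
    using root by simp
  have "of_int (g (Suc d)) ^ Suc e * \<theta> ^ Suc e
      = of_int (g (Suc d)) * \<theta> * (of_int (g (Suc d)) ^ e * \<theta> ^ e)" by (simp add: mult_ac)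
  also have "\<dots> = (\<Sum>l\<le>d. of_int (g (Suc d)) * of_int (c l) * \<theta> ^ Suc l)"
    unfolding c sum_distrib_left by (intro sum.cong) (auto simp: mult_ac)
  also have "\<dots> = (\<Sum>l\<le>Suc d. of_int (if l = 0 then 0 else g (Suc d) * c (l - 1)) * \<theta> ^ l)"
    by (subst sum.atMost_Suc_shift) simp
  also have "\<dots> = (\<Sum>l\<le>d. of_int (if l = 0 then 0 else g (Suc d) * c (l - 1)) * \<theta> ^ l)
      + of_int (c d) * (of_int (g (Suc d)) * \<theta> ^ Suc d)" by simp
  also have "\<dots> = (\<Sum>l\<le>d. of_int (c' l) * \<theta> ^ l)"
    unfolding top c'_def by (simp add: sum_distrib_left sum_subtractf algebra_simps)
  finally have "of_int (g (Suc d)) ^ Suc e * \<theta> ^ Suc e = (\<Sum>l\<le>d. of_int (c' l) * \<theta> ^ l)" .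
  moreover have "\<bar>c' l\<bar> \<le> int ((2 * H) ^ Suc e)" if "l \<le> d" for l
  proof -
    have "\<bar>g (Suc d) * c (l - 1)\<bar> \<le> int H * int ((2 * H) ^ e)"
      unfolding abs_mult using that by (intro mult_mono H cb) auto
    moreover have "\<bar>c d * g l\<bar> \<le> int ((2 * H) ^ e) * int H"
      unfolding abs_mult using that by (intro mult_mono H cb) auto
    moreover have "\<bar>c' l\<bar> \<le> \<bar>g (Suc d) * c (l - 1)\<bar> + \<bar>c d * g l\<bar>"
      unfolding c'_def by (cases "l = 0") (simp_all add: abs_triangle_ineq4)
    ultimately show ?thesis by (simp add: algebra_simps)
  qed
  ultimately show ?case by blast
qed

lemma coeff_shift:
  fixes p :: "real poly"
  assumes "degree p \<le> n"
  shows "coeff (p \<circ>\<^sub>p [:x, 1:]) i = (\<Sum>j\<le>n. coeff p j * (of_nat (j choose i) * x ^ (j - i)))"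
proof -
  have monom: "monom c j \<circ>\<^sub>p [:x, 1:] = smult c ([:x, 1:] ^ j)" for c j
  proof -
    have "[:0, 1:] \<circ>\<^sub>p [:x, 1:] = [:x, 1:]" by (simp add: pcompose_pCons)
    then show ?thesis by (simp only: monom_altdef pcompose_smult pcompose_power)
  qed
  have "p = (\<Sum>j\<le>n. monom (coeff p j) j)" using poly_as_sum_of_monoms'[OF assms] by simp
  then have "p \<circ>\<^sub>p [:x, 1:] = (\<Sum>j\<le>n. monom (coeff p j) j) \<circ>\<^sub>p [:x, 1:]"
    by (rule arg_cong)
  then have "p \<circ>\<^sub>p [:x, 1:] = (\<Sum>j\<le>n. smult (coeff p j) ([:x, 1:] ^ j))"
    by (simp only: pcompose_sum monom)
  moreover have "coeff ([:x, 1:] ^ j) i = of_nat (j choose i) * x ^ (j - i)" for j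
  proof (cases "i \<le> j")
    case True
    then show ?thesis by (simp add: coeff_linear_poly_power)
  next
    case False
    then show ?thesis by (simp add: coeff_eq_0 degree_linear_power binomial_eq_0)
  qed
  ultimately show ?thesis by (simp add: coeff_sum)
qed

text \<open>
The counting condition of \<open>bounded_integer_kernel_vector\<close> for \<open>12 k\<close> equations in \<open>2 (8 k + 1)\<close>
unknowns with coefficients at most \<open>A = 2\<^bsup>8 k\<^esup> (2 H)\<^bsup>8 k + 1\<^esup>\<close>. If \<open>X\<close> bounds
\<open>4 (8 k + 1) A\<close>, the size \<open>B = X\<^sup>3\<close> is enough, because the number of values of one equation is at most
\<open>X B = X\<^sup>4\<close> and \<open>4 \<cdot> 12 k = 3 \<cdot> 16 k\<close>.
\<close>

lemma pigeonhole_parameters: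
  fixes H k :: nat
  assumes "1 \<le> H" "1 \<le> k"
  defines "B \<equiv> ((2 ^ 18 * (2 * H) ^ 9) ^ k) ^ 3"
  shows "(2 * (8 * k + 1) * (2 ^ (8 * k) * (2 * H) ^ (8 * k + 1)) * B + 1) ^ (12 * k)
       < (B + 1) ^ (2 * (8 * k + 1))"
proof -
  define X where "X = (2 ^ 18 * (2 * H) ^ 9) ^ k"
  define T where "T = 2 * (8 * k + 1) * (2 ^ (8 * k) * (2 * H) ^ (8 * k + 1))"
  have X1: "1 \<le> X" using assms(1) by (simp add: X_def)
  have B: "B = X ^ 3" by (simp only: B_def X_def)
  have "8 * k + 1 \<le> 2 ^ (8 * k)" by (metis Suc_eq_plus1 Suc_leI less_exp)
  then have "2 * T \<le> 2 * (2 * 2 ^ (8 * k) * (2 ^ (8 * k) * (2 * H) ^ (8 * k + 1)))"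
    unfolding T_def by (intro mult_mono) auto
  also have "\<dots> = 2 ^ (16 * k + 2) * (2 * H) ^ (8 * k + 1)"
  proof -
    have "(2::nat) ^ (16 * k + 2) = 4 * (2 ^ (8 * k) * 2 ^ (8 * k))" by (simp flip: power_add)
    then show ?thesis by simp
  qed
  also have "\<dots> \<le> 2 ^ (18 * k) * (2 * H) ^ (9 * k)"
    using assms(1,2) by (intro mult_mono power_increasing) auto
  also have "\<dots> = X" by (simp only: X_def power_mult_distrib power_mult)
  finally have T: "2 * T \<le> X" .
  have "0 < T" unfolding T_def using assms(1) by (intro mult_pos_pos) auto
  moreover have "0 < B" unfolding B using X1 by simp
  ultimately have "1 \<le> T * B" by (simp add: Suc_leI)
  then have "T * B + 1 \<le> 2 * T * B" by simp
  also have "\<dots> \<le> X * X ^ 3" unfolding B using T by (intro mult_mono) auto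
  also have "X * X ^ 3 = X ^ 4" by (simp flip: power_Suc)
  finally have "(T * B + 1) ^ (12 * k) \<le> (X ^ 4) ^ (12 * k)" by (intro power_mono) auto
  also have "\<dots> = B ^ (16 * k)" unfolding B power_mult[symmetric] by (rule arg_cong) simp
  also have "\<dots> \<le> (B + 1) ^ (16 * k)" by (intro power_mono) auto
  also have "\<dots> < (B + 1) ^ (2 * (8 * k + 1))"
    using X1 by (intro power_strict_increasing) (auto simp: B)
  finally show ?thesis unfolding T_def .
qed

text \<open>
Each of the \<open>3 k\<close> vanishing conditions for \<open>P - \<theta> Q\<close> at \<open>\<theta>\<close> is an equation in \<open>\<int>[\<theta>]\<close> and follows from \<open>4\<close>
integer equations in the coefficients of \<open>P\<close> and \<open>Q\<close>. The order \<open>3 k\<close> is a compromise: Thue's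
argument for exponent \<open>4\<close> needs an order above a third of the degree \<open>8 k\<close>, and counting equations
allows anything below one half.
\<close>

lemma auxiliary_polynomials:
  assumes g: "int_coeffs g" "degree g = 4" "poly g \<theta> = 0"
  shows "\<exists>C\<ge>1. \<forall>k\<ge>1. \<exists>P Q. int_coeffs P \<and> int_coeffs Q \<and> (P \<noteq> 0 \<or> Q \<noteq> 0)
           \<and> degree P \<le> 8 * k \<and> degree Q \<le> 8 * k \<and> poly_length P \<le> C ^ k \<and> poly_length Q \<le> C ^ k
           \<and> [:- \<theta>, 1:] ^ (3 * k) dvd P - smult \<theta> Q"
proof -
  have "\<forall>i. \<exists>c::int. coeff g i = of_int c"
    using g(1) by (auto simp: int_coeffs_def elim: Ints_cases)
  then obtain \<gamma> :: "nat \<Rightarrow> int" where \<gamma>: "\<And>i. coeff g i = of_int (\<gamma> i)" by metis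
  define H where "H = nat (\<Sum>i\<le>4. \<bar>\<gamma> i\<bar>)"
  have H: "\<bar>\<gamma> i\<bar> \<le> int H" if "i \<le> 4" for i
    using that member_le_sum[of i "{..4}" "\<lambda>i. \<bar>\<gamma> i\<bar>"] by (simp add: H_def)
  have lead: "\<gamma> 4 \<noteq> 0" using g(2) \<gamma>[of 4] leading_coeff_0_iff[of g] by auto
  have H1: "1 \<le> H" using H[of 4] lead by linarith
  have root: "(\<Sum>i\<le>Suc 3. of_int (\<gamma> i) * \<theta> ^ i) = 0" using g(2,3) by (simp add: poly_altdef \<gamma>)
  have "\<exists>c :: nat \<Rightarrow> int. of_int (\<gamma> (Suc 3)) ^ e * \<theta> ^ e = (\<Sum>l\<le>3. of_int (c l) * \<theta> ^ l)
           \<and> (\<forall>l\<le>3. \<bar>c l\<bar> \<le> int ((2 * H) ^ e))" for e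
    by (rule powers_of_root_reduced[OF root]) (simp add: H)
  then have "\<exists>c :: nat \<Rightarrow> int. of_int (\<gamma> 4) ^ e * \<theta> ^ e = (\<Sum>l\<le>3. of_int (c l) * \<theta> ^ l)
           \<and> (\<forall>l\<le>3. \<bar>c l\<bar> \<le> int ((2 * H) ^ e))" for e
    by simp
  then obtain c where c: "\<And>e. of_int (\<gamma> 4) ^ e * \<theta> ^ e = (\<Sum>l\<le>3. of_int (c e l) * \<theta> ^ l)"
    and cb: "\<And>e l. l \<le> 3 \<Longrightarrow> \<bar>c e l\<bar> \<le> int ((2 * H) ^ e)"
    by metis
  define Y where "Y = 2 ^ 18 * (2 * H) ^ 9"
  have Y1: "1 \<le> Y" using H1 by (simp add: Y_def)
  have "\<exists>P Q. int_coeffs P \<and> int_coeffs Q \<and> (P \<noteq> 0 \<or> Q \<noteq> 0)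
      \<and> degree P \<le> 8 * k \<and> degree Q \<le> 8 * k
      \<and> poly_length P \<le> real (9 * Y ^ 3) ^ k \<and> poly_length Q \<le> real (9 * Y ^ 3) ^ k
      \<and> [:- \<theta>, 1:] ^ (3 * k) dvd P - smult \<theta> Q" if k: "k \<ge> 1" for k
  proof -
    define D where "D = 8 * k"
    define cc where "cc e l = \<gamma> 4 ^ (D + 1 - e) * c e l" for e l
    have cc: "of_int (\<gamma> 4) ^ (D + 1) * \<theta> ^ e = (\<Sum>l\<le>3. of_int (cc e l) * \<theta> ^ l)" if "e \<le> D + 1" for e
    proof -
      have "real_of_int (\<gamma> 4) ^ (D + 1) * \<theta> ^ e
          = of_int (\<gamma> 4) ^ (D + 1 - e) * (of_int (\<gamma> 4) ^ e * \<theta> ^ e)"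
        using that by (simp add: mult.assoc[symmetric] del: power_Suc flip: power_add)
      also have "\<dots> = (\<Sum>l\<le>3. of_int (cc e l) * \<theta> ^ l)"
        unfolding c cc_def by (simp add: sum_distrib_left mult.assoc)
      finally show ?thesis .
    qed
    have ccb: "\<bar>cc e l\<bar> \<le> int ((2 * H) ^ (D + 1))" if "e \<le> D + 1" "l \<le> 3" for e l
    proof -
      have "\<bar>\<gamma> 4\<bar> ^ (D + 1 - e) \<le> int (2 * H) ^ (D + 1 - e)"
        using H[of 4] by (intro power_mono) auto
      then have "\<bar>cc e l\<bar> \<le> int (2 * H) ^ (D + 1 - e) * int ((2 * H) ^ e)"
        unfolding cc_def abs_mult power_abs by (intro mult_mono cb that) auto
      also have "\<dots> = int ((2 * H) ^ (D + 1))"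
        unfolding of_nat_power power_add[symmetric] using that by (simp only: le_add_diff_inverse2)
      finally show ?thesis .
    qed
    define I where "I = (UNIV :: bool set) \<times> {..D}"
    define R where "R = {..<3 * k} \<times> {..3::nat}"
    \<comment> \<open>The unknown \<open>(b, j)\<close> is the coefficient of index \<open>j\<close> of \<open>P\<close> (for \<open>b = False\<close>) or of \<open>Q\<close> (for
      \<open>b = True\<close>). The equation \<open>(i, l)\<close> says that \<open>\<theta>\<^sup>l\<close> has coefficient zero in the \<open>i\<close>-th Taylor
      coefficient of \<open>P - \<theta> Q\<close> at \<open>\<theta>\<close>, multiplied by the power \<open>D + 1\<close> of the leading coefficient of \<open>g\<close>.\<close>
    define a where "a = (\<lambda>(i, l) (b, j). int (j choose i) * (if b then - cc (j - i + 1) l else cc (j - i) l))"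
    define A where "A = 2 ^ (8 * k) * (2 * H) ^ (8 * k + 1)"
    define B where "B = (Y ^ k) ^ 3"
    have cards: "card I = 2 * (8 * k + 1)" "card R = 12 * k"
      by (simp_all add: I_def R_def D_def card_cartesian_product)
    have sum_I: "(\<Sum>s\<in>I. h s) = (\<Sum>j\<le>D. h (False, j)) + (\<Sum>j\<le>D. h (True, j))" for h :: "_ \<Rightarrow> int"
    proof -
      have "(\<Sum>s\<in>I. h s) = (\<Sum>b\<in>UNIV. \<Sum>j\<le>D. h (b, j))"
        unfolding I_def by (simp add: sum.cartesian_product)
      then show ?thesis by (simp add: UNIV_bool)
    qed
    have a_le: "\<bar>a r s\<bar> \<le> int A" if rs: "r \<in> R" "s \<in> I" for r s
    proof -
      obtain i l where r: "r = (i, l)" "l \<le> 3" using rs by (auto simp: R_def)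
      obtain b j where s: "s = (b, j)" "j \<le> D" using rs by (auto simp: I_def)
      have "j choose i \<le> 2 ^ D"
        using binomial_le_pow2[of j i] s(2) power_increasing[of j D "2::nat"] by linarith
      then have "int (j choose i) \<le> 2 ^ D" using of_nat_mono[of _ "2 ^ D", where 'a = int] by simp
      moreover have "\<bar>if b then - cc (j - i + 1) l else cc (j - i) l\<bar> \<le> int ((2 * H) ^ (D + 1))"
        using ccb[of "j - i + 1" l] ccb[of "j - i" l] r s by auto
      ultimately have "\<bar>a r s\<bar> \<le> 2 ^ D * int ((2 * H) ^ (D + 1))"
        unfolding a_def r s prod.case abs_mult by (intro mult_mono) auto
      then show ?thesis by (simp add: A_def D_def)
    qed
    have many: "(card I * A * B + 1) ^ card R < (B + 1) ^ card I"
      using pigeonhole_parameters[OF H1 k] unfolding cards A_def B_def Y_def .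
    obtain x where x: "\<exists>s\<in>I. x s \<noteq> 0" "\<forall>s\<in>I. \<bar>x s\<bar> \<le> int B" "\<forall>r\<in>R. (\<Sum>s\<in>I. a r s * x s) = 0"
      using bounded_integer_kernel_vector[of R I a A B, OF _ _ a_le many] by (auto simp: R_def I_def)
    define pl where "pl b = (\<Sum>j\<le>D. monom (real_of_int (x (b, j))) j)" for b
    have coeff: "coeff (pl b) j = (if j \<le> D then of_int (x (b, j)) else 0)" for b j
      by (simp add: pl_def coeff_sum)
    have deg: "degree (pl b) \<le> D" for b by (rule degree_le) (simp add: coeff)
    have "\<bar>x (b, j)\<bar> \<le> int B" if "j \<le> D" for b j using x(2) that by (auto simp: I_def)
    then have "real_of_int \<bar>x (b, j)\<bar> \<le> real_of_int (int B)" if "j \<le> D" for b j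
      using that unfolding of_int_le_iff .
    then have xb: "\<bar>real_of_int (x (b, j))\<bar> \<le> real B" if "j \<le> D" for b j
      using that by simp
    have len: "poly_length (pl b) \<le> real (9 * Y ^ 3) ^ k" for b
    proof -
      have "poly_length (pl b) = (\<Sum>j\<le>D. \<bar>coeff (pl b) j\<bar>)" by (rule poly_length_altdef[OF deg])
      also have "\<dots> \<le> (\<Sum>j\<le>D. real B)" using xb by (intro sum_mono) (simp add: coeff)
      also have "\<dots> = real (8 * k + 1) * real (Y ^ 3) ^ k"
        by (simp add: D_def B_def mult.commute flip: power_mult)
      also have "real (8 * k + 1) \<le> 9 ^ k"
        using Bernoulli_inequality[of 8 k] by (simp add: mult.commute)
      also have "9 ^ k * real (Y ^ 3) ^ k = real (9 * Y ^ 3) ^ k" by (simp add: power_mult_distrib)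
      finally show ?thesis by (simp add: mult_right_mono)
    qed
    have "coeff ((pl False - smult \<theta> (pl True)) \<circ>\<^sub>p [:\<theta>, 1:]) i = 0" if i: "i < 3 * k" for i
    proof -
      define G where "G = real_of_int (\<gamma> 4) ^ (D + 1)"
      have "coeff ((pl False - smult \<theta> (pl True)) \<circ>\<^sub>p [:\<theta>, 1:]) i
          = (\<Sum>j\<le>D. of_int (x (False, j)) * (of_nat (j choose i) * \<theta> ^ (j - i)))
          - \<theta> * (\<Sum>j\<le>D. of_int (x (True, j)) * (of_nat (j choose i) * \<theta> ^ (j - i)))"
        by (simp add: pcompose_diff pcompose_smult coeff_shift[OF deg] coeff)
      then have "G * coeff ((pl False - smult \<theta> (pl True)) \<circ>\<^sub>p [:\<theta>, 1:]) i
          = (\<Sum>j\<le>D. of_int (int (j choose i) * x (False, j)) * (G * \<theta> ^ (j - i)))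
          - (\<Sum>j\<le>D. of_int (int (j choose i) * x (True, j)) * (G * \<theta> ^ (j - i + 1)))"
        by (simp add: right_diff_distrib sum_distrib_left mult_ac)
      also have "\<dots> = (\<Sum>j\<le>D. of_int (int (j choose i) * x (False, j)) * (\<Sum>l\<le>3. of_int (cc (j - i) l) * \<theta> ^ l))
          - (\<Sum>j\<le>D. of_int (int (j choose i) * x (True, j)) * (\<Sum>l\<le>3. of_int (cc (j - i + 1) l) * \<theta> ^ l))"
        unfolding G_def by (intro arg_cong2[where f = "(-)"] sum.cong refl arg_cong2[where f = "(*)"] cc) auto
      also have "\<dots> = (\<Sum>j\<le>D. \<Sum>l\<le>3. of_int (a (i, l) (False, j) * x (False, j)) * \<theta> ^ l)
          + (\<Sum>j\<le>D. \<Sum>l\<le>3. of_int (a (i, l) (True, j) * x (True, j)) * \<theta> ^ l)"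
        by (simp add: a_def sum_distrib_left sum_negf mult_ac)
      also have "\<dots> = (\<Sum>l\<le>3. of_int ((\<Sum>j\<le>D. a (i, l) (False, j) * x (False, j))
            + (\<Sum>j\<le>D. a (i, l) (True, j) * x (True, j))) * \<theta> ^ l)"
        by (subst (1 2) sum.swap) (simp add: sum_distrib_right sum.distrib distrib_right)
      also have "\<dots> = (\<Sum>l\<le>3. of_int (\<Sum>s\<in>I. a (i, l) s * x s) * \<theta> ^ l)"
        unfolding sum_I ..
      also have "\<dots> = 0" using x(3) i by (intro sum.neutral) (simp add: R_def)
      finally show ?thesis using lead by (simp add: G_def)
    qed
    then have "[:- \<theta>, 1:] ^ (3 * k) dvd pl False - smult \<theta> (pl True)"
      by (simp flip: coeff_shift_eq_0_iff)
    moreover have "pl False \<noteq> 0 \<or> pl True \<noteq> 0"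
    proof -
      obtain b j where "x (b, j) \<noteq> 0" "j \<le> D" using x(1) by (auto simp: I_def)
      then have "coeff (pl b) j \<noteq> 0" by (simp add: coeff)
      then have "pl b \<noteq> 0" by auto
      then show ?thesis by (cases b) auto
    qed
    moreover have "int_coeffs (pl b)" for b by (simp add: int_coeffs_def coeff)
    ultimately show ?thesis
      using len deg unfolding D_def by (intro exI[of _ "pl False"] exI[of _ "pl True"] conjI)
  qed
  moreover have "1 \<le> real (9 * Y ^ 3)"
  proof -
    have "1 \<le> 9 * Y ^ 3" using Y1 by simp
    then show ?thesis by linarith
  qed
  ultimately show ?thesis by (intro exI[of _ "real (9 * Y ^ 3)"]) simp
qed

section \<open>Minimal degree and the Wronskian\<close>

lemma degree_pos_of_root:
  fixes p :: "real poly"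
  assumes "p \<noteq> 0" "poly p x = 0"
  shows "degree p > 0"
proof (rule ccontr)
  assume "\<not> degree p > 0"
  then obtain c where "p = [:c:]" by (auto elim: degree_eq_zeroE)
  then show False using assms by simp
qed

text \<open>
Division with remainder by a polynomial of minimal degree, with denominators cleared: the
remainder would have smaller degree and the same root, so it vanishes.
\<close>

lemma multiple_of_minimal_degree_poly:
  assumes g: "int_coeffs g" "g \<noteq> 0"
    and min: "\<And>h. int_coeffs h \<Longrightarrow> h \<noteq> 0 \<Longrightarrow> poly h \<theta> = 0 \<Longrightarrow> degree g \<le> degree h"
    and root: "poly g \<theta> = 0"
    and p: "int_coeffs p" "poly p \<theta> = 0"
  shows "\<exists>c h. c \<noteq> 0 \<and> c \<in> \<int> \<and> int_coeffs h \<and> smult c p = g * h"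
  using p
proof (induction "degree p" arbitrary: p rule: less_induct)
  case less
  show ?case
  proof (cases "p = 0")
    case True
    then show ?thesis by (intro exI[of _ 1] exI[of _ 0]) (simp add: int_coeffs_def)
  next
    case False
    have le: "degree g \<le> degree p" using min less.prems False by blast
    have pos: "degree g > 0" using g(2) root by (rule degree_pos_of_root)
    define m where "m = monom (lead_coeff p) (degree p - degree g)"
    define r where "r = smult (lead_coeff g) p - m * g"
    have im: "int_coeffs m" unfolding m_def using less.prems by (intro int_coeffs_monom) (simp add: int_coeffs_def)
    have ir: "int_coeffs r" unfolding r_def
      using g(1) less.prems by (intro int_coeffs_diff int_coeffs_smult int_coeffs_mult im) (auto simp: int_coeffs_def)
    have "m \<noteq> 0" using False by (simp add: m_def)
    have "degree r < degree (smult (lead_coeff g) p)" unfolding r_def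
    proof (rule degree_diff_less_lead)
      have "degree (m * g) = degree m + degree g" using \<open>m \<noteq> 0\<close> g(2) by (rule degree_mult_eq)
      also have "degree m = degree p - degree g" unfolding m_def using False by (simp add: degree_monom_eq)
      finally show "degree (smult (lead_coeff g) p) = degree (m * g)" using le g(2) by simp
      show "lead_coeff (smult (lead_coeff g) p) = lead_coeff (m * g)"
        unfolding lead_coeff_mult lead_coeff_smult using False by (simp add: m_def degree_monom_eq)
    qed (use le pos g(2) in simp)
    then have "degree r < degree p" using g(2) by simp
    moreover have "poly r \<theta> = 0" using less.prems root by (simp add: r_def)
    ultimately obtain c h where ch: "c \<noteq> 0" "c \<in> \<int>" "int_coeffs h" "smult c r = g * h"
      using less.hyps ir by blast
    then have eq: "smult (c * lead_coeff g) p = g * (h + smult c m)"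
      by (simp add: r_def smult_diff_right algebra_simps)
    have "c * lead_coeff g \<in> \<int>" using ch(2) g(1) by (simp add: int_coeffs_def)
    moreover have "int_coeffs (h + smult c m)" by (intro int_coeffs_add int_coeffs_smult ch im)
    moreover have "c * lead_coeff g \<noteq> 0" using ch(1) g(2) by simp
    ultimately show ?thesis using eq by blast
  qed
qed

text \<open>
A polynomial of minimal degree has \<open>\<theta>\<close> as a simple root, so each order of vanishing at \<open>\<theta>\<close> of an
integer polynomial costs one factor of this minimal degree.
\<close>

lemma minimal_degree_mult_order_le:
  assumes g: "int_coeffs g" "g \<noteq> 0"
    and min: "\<And>h. int_coeffs h \<Longrightarrow> h \<noteq> 0 \<Longrightarrow> poly h \<theta> = 0 \<Longrightarrow> degree g \<le> degree h"
    and root: "poly g \<theta> = 0"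
    and p: "int_coeffs p" "p \<noteq> 0" "[:- \<theta>, 1:] ^ m dvd p"
  shows "degree g * m \<le> degree p"
  using p
proof (induction m arbitrary: p)
  case (Suc m)
  have pos: "degree g > 0" using g(2) root by (rule degree_pos_of_root)
  have "\<not> [:- \<theta>, 1:] ^ 2 dvd g"
  proof
    assume "[:- \<theta>, 1:] ^ 2 dvd g"
    then obtain h where h: "g = [:- \<theta>, 1:] ^ 2 * h" ..
    define l where "l = [:- \<theta>, 1:]"
    have "poly l \<theta> = 0" by (simp add: l_def)
    moreover have "g = l * (l * h)" unfolding h l_def[symmetric] by (simp add: power2_eq_square)
    ultimately have "poly (pderiv g) \<theta> = 0" by (simp add: pderiv_mult)
    moreover have "pderiv g \<noteq> 0" using pos by (simp add: pderiv_eq_0_iff)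
    ultimately have "degree g \<le> degree (pderiv g)" using min int_coeffs_pderiv[OF g(1)] by blast
    then show False using pos by (simp add: degree_pderiv)
  qed
  then have order_g: "order \<theta> g \<le> 1" using g(2) by (simp add: order_divides)
  have "[:- \<theta>, 1:] dvd p" using Suc.prems(3) unfolding power_Suc by (rule dvd_mult_left)
  then have "poly p \<theta> = 0" by (simp add: poly_eq_0_iff_dvd)
  then obtain c h where ch: "c \<noteq> 0" "int_coeffs h" "smult c p = g * h"
    using multiple_of_minimal_degree_poly[OF g min root Suc.prems(1)] by blast
  have h0: "g * h \<noteq> 0" using ch Suc.prems(2) by (metis smult_eq_0_iff)
  then have h: "h \<noteq> 0" by auto
  have "Suc m \<le> order \<theta> p" using Suc.prems by (simp only: order_divides) simp
  also have "\<dots> = order \<theta> g + order \<theta> h" using ch order_mult[OF h0] by (metis order_smult)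
  finally have "m \<le> order \<theta> h" using order_g by simp
  then have "degree g * m \<le> degree h" using Suc.IH ch(2) h by (simp add: order_divides)
  moreover have "degree p = degree g + degree h"
    using ch degree_mult_eq[OF g(2) h] by (metis degree_smult_eq)
  ultimately show ?case by simp
qed simp

definition wronskian :: "real poly \<Rightarrow> real poly \<Rightarrow> real poly" where
  "wronskian P Q = P * pderiv Q - Q * pderiv P"

lemma lead_coeff_pderiv: "lead_coeff (pderiv p) = of_nat (degree p) * lead_coeff p" for p :: "real poly"
proof (cases "degree p")
  case 0
  then have "pderiv p = 0" by (simp add: pderiv_eq_0_iff)
  then show ?thesis using 0 by simp
next
  case (Suc n)
  then show ?thesis by (simp add: degree_pderiv coeff_pderiv)
qed

text \<open>
The leading coefficients of \<open>A Q'\<close> and \<open>Q A'\<close> are those of \<open>A Q\<close> times the degree of \<open>Q\<close> and of \<open>A\<close>.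
\<close>

lemma wronskian_eq_0_imp_degree_eq:
  assumes "wronskian A Q = 0" "A \<noteq> 0" "Q \<noteq> 0"
  shows "degree A = degree Q"
proof -
  have "A * pderiv Q = Q * pderiv A" using assms(1) by (simp add: wronskian_def)
  then have "lead_coeff (A * pderiv Q) = lead_coeff (Q * pderiv A)" by simp
  then show ?thesis using assms(2,3) unfolding lead_coeff_mult lead_coeff_pderiv by simp
qed

lemma wronskian_eq_0_imp_proportional:
  assumes "wronskian P Q = 0" "Q \<noteq> 0"
  shows "P = smult (coeff P (degree Q) / lead_coeff Q) Q"
proof (rule ccontr)
  define A where "A = P - smult (coeff P (degree Q) / lead_coeff Q) Q"
  assume "P \<noteq> smult (coeff P (degree Q) / lead_coeff Q) Q"
  then have "A \<noteq> 0" by (simp add: A_def)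
  have "wronskian A Q = wronskian P Q"
    by (simp add: wronskian_def A_def pderiv_diff pderiv_smult algebra_simps)
  then have "degree A = degree Q" using wronskian_eq_0_imp_degree_eq assms \<open>A \<noteq> 0\<close> by simp
  moreover have "coeff A (degree Q) = 0" using assms(2) by (simp add: A_def)
  ultimately show False using \<open>A \<noteq> 0\<close> by (metis leading_coeff_0_iff)
qed

text \<open>
If the Wronskian vanished, \<open>P\<close> and \<open>Q\<close> would be proportional over the rationals, and one of them would
itself vanish at \<open>\<theta>\<close> to order \<open>3 k\<close>. As \<open>\<theta>\<close> has degree \<open>4\<close>, this would require degree \<open>12 k > 8 k\<close>.
\<close>

lemma wronskian_nonzero:
  assumes min: "\<And>h. int_coeffs h \<Longrightarrow> h \<noteq> 0 \<Longrightarrow> poly h \<theta> = 0 \<Longrightarrow> 4 \<le> degree h"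
    and g: "int_coeffs g" "degree g = 4" "poly g \<theta> = 0"
    and PQ: "int_coeffs P" "int_coeffs Q" "P \<noteq> 0 \<or> Q \<noteq> 0" "degree P \<le> 8 * k" "degree Q \<le> 8 * k"
    and k: "k \<ge> 1" and van: "[:- \<theta>, 1:] ^ (3 * k) dvd P - smult \<theta> Q"
  shows "wronskian P Q \<noteq> 0"
proof
  assume W: "wronskian P Q = 0"
  have no: False if "int_coeffs h" "h \<noteq> 0" "degree h \<le> 8 * k" "[:- \<theta>, 1:] ^ (3 * k) dvd h" for h
  proof -
    have "g \<noteq> 0" using g(2) by auto
    then have "degree g * (3 * k) \<le> degree h"
      using g min that by (intro minimal_degree_mult_order_le[where \<theta> = \<theta>]) auto
    then show False using g(2) that(3) k by simp
  qed
  show False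
  proof (cases "Q = 0")
    case True
    then show False using no[of P] PQ van by simp
  next
    case False
    define c where "c = coeff P (degree Q) / lead_coeff Q"
    have P: "P = smult c Q" unfolding c_def by (rule wronskian_eq_0_imp_proportional[OF W False])
    \<comment> \<open>\<open>c\<close> is rational, and \<open>\<theta>\<close> is not.\<close>
    have "c \<noteq> \<theta>"
    proof
      assume "c = \<theta>"
      then have "poly [:- coeff P (degree Q), lead_coeff Q:] \<theta> = 0" using False by (simp add: c_def field_simps)
      moreover have "int_coeffs [:- coeff P (degree Q), lead_coeff Q:]"
        using PQ(1,2) by (simp add: int_coeffs_pCons) (simp add: int_coeffs_def)
      ultimately have "4 \<le> degree [:- coeff P (degree Q), lead_coeff Q:]" using False by (intro min) auto
      then show False by (simp split: if_splits)
    qed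
    moreover have "P - smult \<theta> Q = smult (c - \<theta>) Q" by (subst P) (simp add: smult_diff_left)
    ultimately have "[:- \<theta>, 1:] ^ (3 * k) dvd Q" using van by (simp add: dvd_smult_iff)
    then show False using no[of Q] PQ False by simp
  qed
qed

section \<open>Two good approximations\<close>

lemma Ints_denominator_power_mult_coeff_shift:
  assumes "int_coeffs p" "degree p \<le> n" "q > 0"
  shows "of_int q ^ n * coeff (p \<circ>\<^sub>p [:of_int a / of_int q, 1:]) i \<in> \<int>"
proof -
  have "of_int q ^ n * (coeff p j * (of_nat (j choose i) * (of_int a / of_int q) ^ (j - i))) \<in> \<int>"
    if "j \<le> n" for j
  proof -
    have "real_of_int q ^ n = of_int q ^ (n - (j - i)) * of_int q ^ (j - i)"
      using that by (simp flip: power_add)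
    then have "of_int q ^ n * (coeff p j * (of_nat (j choose i) * (of_int a / of_int q) ^ (j - i)))
        = of_int q ^ (n - (j - i)) * (coeff p j * (of_nat (j choose i) * of_int a ^ (j - i)))"
      using assms(3) by (simp add: power_divide)
    also have "\<dots> \<in> \<int>" using assms(1) by (simp add: int_coeffs_def)
    finally show ?thesis .
  qed
  then show ?thesis unfolding coeff_shift[OF assms(2)] sum_distrib_left by (intro Ints_sum) auto
qed

text \<open>
Write \<open>S = (y - \<theta>)\<^sup>m T(y)\<close>. The \<open>j\<close>-th Taylor coefficient of the first factor at \<open>x\<close> carries the power
\<open>m - j\<close> of \<open>x - \<theta>\<close>, and \<open>T\<close> is controlled because its coefficients at \<open>\<theta>\<close> are those of \<open>S\<close>, shifted by
\<open>m\<close> places. Dividing \<open>S\<close> by the linear factors one at a time would lose a factor at every step.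
\<close>

lemma abs_coeff_shift_near_high_order_root:
  assumes "[:- \<theta>, 1:] ^ m dvd S" "degree S \<le> n" "\<bar>x - \<theta>\<bar> \<le> 1"
  shows "\<bar>coeff (S \<circ>\<^sub>p [:x, 1:]) j\<bar> \<le> \<bar>x - \<theta>\<bar> ^ (m - j) * (2 ^ m * (2 ^ n * (poly_length S * (1 + \<bar>\<theta>\<bar>) ^ n)))"
proof -
  define \<delta> where "\<delta> = x - \<theta>"
  define l where "l = [:- \<theta>, 1:]"
  obtain T0 where T0: "S = l ^ m * T0" using assms(1) unfolding l_def ..
  define T where "T = T0 \<circ>\<^sub>p [:\<theta>, 1:]"
  have l1: "l \<circ>\<^sub>p [:\<theta>, 1:] = [:0, 1:]" by (simp add: l_def pcompose_pCons)
  have l2: "l \<circ>\<^sub>p [:x, 1:] = [:\<delta>, 1:]" by (simp add: l_def \<delta>_def pcompose_pCons)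
  have S\<theta>: "S \<circ>\<^sub>p [:\<theta>, 1:] = monom 1 m * T"
    unfolding T0 pcompose_mult pcompose_power l1 T_def by (simp add: monom_altdef)
  have "[:\<theta>, 1:] \<circ>\<^sub>p [:\<delta>, 1:] = [:x, 1:]" by (simp add: pcompose_pCons \<delta>_def)
  then have Sx: "S \<circ>\<^sub>p [:x, 1:] = [:\<delta>, 1:] ^ m * T \<circ>\<^sub>p [:\<delta>, 1:]"
    unfolding T0 pcompose_mult pcompose_power l2 T_def by (simp flip: pcompose_assoc)
  have len_mono: "poly_length (monom 1 m * T) = poly_length T"
    by (induction m) (simp_all add: monom_Suc)
  have "degree S = degree (monom 1 m * T)" using degree_pcompose[of S "[:\<theta>, 1:]"] S\<theta> by simp
  then have degT: "degree T \<le> n"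
    using assms(2) degree_mult_right_le[of "monom 1 m" T] by (cases "T = 0") (simp_all add: degree_mult_eq monom_eq_0_iff)
  have "poly_length T \<le> poly_length S * (1 + \<bar>\<theta>\<bar>) ^ n"
    unfolding len_mono[symmetric] S\<theta>[symmetric] using assms(2) by (intro poly_length_pcompose) auto
  moreover have "poly_length (T \<circ>\<^sub>p [:\<delta>, 1:]) \<le> poly_length T * 2 ^ n"
    using assms(3) degT by (intro poly_length_pcompose) (auto simp: \<delta>_def)
  ultimately have lenT: "poly_length (T \<circ>\<^sub>p [:\<delta>, 1:]) \<le> 2 ^ n * (poly_length S * (1 + \<bar>\<theta>\<bar>) ^ n)"
    by (smt (verit) mult.commute mult_right_mono zero_le_power)
  have bin: "\<bar>coeff ([:\<delta>, 1:] ^ m) i\<bar> \<le> 2 ^ m * \<bar>\<delta>\<bar> ^ (m - j)" if "i \<le> j" for i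
  proof (cases "i \<le> m")
    case True
    have "real (m choose i) \<le> 2 ^ m"
      using binomial_le_pow2[of m i] by (metis of_nat_le_iff of_nat_numeral of_nat_power)
    moreover have "\<bar>\<delta>\<bar> ^ (m - i) \<le> \<bar>\<delta>\<bar> ^ (m - j)"
      using assms(3) that unfolding \<delta>_def by (intro power_decreasing) auto
    ultimately show ?thesis
      using True by (simp add: coeff_linear_poly_power abs_mult power_abs mult_mono)
  next
    case False
    then show ?thesis by (simp add: coeff_eq_0 degree_linear_power)
  qed
  have "(\<Sum>i\<le>j. \<bar>coeff (T \<circ>\<^sub>p [:\<delta>, 1:]) (j - i)\<bar>) = (\<Sum>i\<le>j. \<bar>coeff (T \<circ>\<^sub>p [:\<delta>, 1:]) i\<bar>)"
    using sum.nat_diff_reindex[of "\<lambda>i. \<bar>coeff (T \<circ>\<^sub>p [:\<delta>, 1:]) i\<bar>" "Suc j"] by (simp add: lessThan_Suc_atMost)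
  also have "\<dots> \<le> (\<Sum>i\<le>max j (degree (T \<circ>\<^sub>p [:\<delta>, 1:])). \<bar>coeff (T \<circ>\<^sub>p [:\<delta>, 1:]) i\<bar>)"
    by (intro sum_mono2) auto
  also have "\<dots> = poly_length (T \<circ>\<^sub>p [:\<delta>, 1:])" by (rule poly_length_altdef[symmetric]) simp
  also have "\<dots> \<le> 2 ^ n * (poly_length S * (1 + \<bar>\<theta>\<bar>) ^ n)" by (rule lenT)
  finally have sum_T: "(\<Sum>i\<le>j. \<bar>coeff (T \<circ>\<^sub>p [:\<delta>, 1:]) (j - i)\<bar>)
      \<le> 2 ^ n * (poly_length S * (1 + \<bar>\<theta>\<bar>) ^ n)" .
  have "\<bar>coeff (S \<circ>\<^sub>p [:x, 1:]) j\<bar>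
      = \<bar>\<Sum>i\<le>j. coeff ([:\<delta>, 1:] ^ m) i * coeff (T \<circ>\<^sub>p [:\<delta>, 1:]) (j - i)\<bar>"
    by (simp add: Sx coeff_mult)
  also have "\<dots> \<le> (\<Sum>i\<le>j. \<bar>coeff ([:\<delta>, 1:] ^ m) i\<bar> * \<bar>coeff (T \<circ>\<^sub>p [:\<delta>, 1:]) (j - i)\<bar>)"
    unfolding abs_mult[symmetric] by (rule sum_abs)
  also have "\<dots> \<le> (\<Sum>i\<le>j. 2 ^ m * \<bar>\<delta>\<bar> ^ (m - j) * \<bar>coeff (T \<circ>\<^sub>p [:\<delta>, 1:]) (j - i)\<bar>)"
    using bin by (intro sum_mono mult_right_mono) auto
  also have "\<dots> = 2 ^ m * \<bar>\<delta>\<bar> ^ (m - j) * (\<Sum>i\<le>j. \<bar>coeff (T \<circ>\<^sub>p [:\<delta>, 1:]) (j - i)\<bar>)"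
    by (simp add: sum_distrib_left)
  also have "\<dots> \<le> 2 ^ m * \<bar>\<delta>\<bar> ^ (m - j) * (2 ^ n * (poly_length S * (1 + \<bar>\<theta>\<bar>) ^ n))"
    using sum_T by (intro mult_left_mono) auto
  finally show ?thesis unfolding \<delta>_def by (simp add: mult_ac)
qed

text \<open>
If \<open>F = b P - a Q\<close> vanishes at a fraction to order \<open>j\<close>, then \<open>b\<close> times the Wronskian of \<open>P\<close> and \<open>Q\<close>
equals the Wronskian of \<open>F\<close> and \<open>Q\<close> and vanishes there to order \<open>j - 1\<close>. The Wronskian does not depend
on \<open>a\<close> and \<open>b\<close>, so Gauss's lemma bounds the power \<open>j - 1\<close> of the denominator by its length.
\<close>

lemma order_at_fraction_bounded_by_wronskian:
  fixes a b :: real and p0 q0 :: int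
  assumes PQ: "int_coeffs P" "int_coeffs Q" "degree P \<le> n" "degree Q \<le> n" and W: "wronskian P Q \<noteq> 0"
    and q: "coprime p0 q0" "q0 > 0" "b \<noteq> 0"
  defines "j \<equiv> order (of_int p0 / of_int q0) (smult b P - smult a Q)"
  shows "smult b P - smult a Q \<noteq> 0" and "of_int q0 ^ j \<le> of_int q0 * (2 * real n * (poly_length P * poly_length Q) + 1)"
proof -
  define F where "F = smult b P - smult a Q"
  define x :: real where "x = of_int p0 / of_int q0"
  define l where "l = [:- x, 1:]"
  have WF: "smult b (wronskian P Q) = wronskian F Q"
    by (simp add: wronskian_def F_def pderiv_diff pderiv_smult algebra_simps smult_diff_right)
  show F0: "smult b P - smult a Q \<noteq> 0"
  proof
    assume "smult b P - smult a Q = 0"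
    then have "smult b (wronskian P Q) = 0" unfolding WF F_def by (simp add: wronskian_def)
    then show False using W q(3) by simp
  qed
  show "of_int q0 ^ j \<le> of_int q0 * (2 * real n * (poly_length P * poly_length Q) + 1)"
  proof (cases j)
    case 0
    have "1 * 1 \<le> real_of_int q0 * (2 * real n * (poly_length P * poly_length Q) + 1)"
      using q(2) by (intro mult_mono) auto
    then show ?thesis using 0 by simp
  next
    case (Suc i)
    have "l ^ Suc i dvd F" using order_1[of x F] Suc unfolding j_def F_def l_def x_def by simp
    then obtain h where h: "F = l ^ Suc i * h" ..
    have "pderiv F = l ^ i * (smult (of_nat (Suc i)) h * pderiv l + l * pderiv h)"
      unfolding h pderiv_mult pderiv_power_Suc by (simp add: algebra_simps)
    then have "wronskian F Q = l ^ i * (l * h * pderiv Q - Q * (smult (of_nat (Suc i)) h * pderiv l + l * pderiv h))"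
      unfolding wronskian_def by (subst h) (simp add: algebra_simps)
    then have "l ^ i dvd smult b (wronskian P Q)" unfolding WF by simp
    then have "l ^ i dvd wronskian P Q" using q(3) by (simp add: dvd_smult_iff)
    moreover have "int_coeffs (wronskian P Q)"
      unfolding wronskian_def by (intro int_coeffs_diff int_coeffs_mult int_coeffs_pderiv PQ)
    ultimately have "of_int q0 ^ i \<le> \<bar>lead_coeff (wronskian P Q)\<bar>"
      using W q unfolding l_def x_def by (intro denominator_power_le_lead_coeff)
    also have "\<dots> \<le> poly_length (wronskian P Q)" by (rule abs_coeff_le_poly_length)
    also have "\<dots> \<le> poly_length (P * pderiv Q) + poly_length (Q * pderiv P)"
      unfolding wronskian_def by (rule poly_length_diff)
    also have "\<dots> \<le> poly_length P * poly_length (pderiv Q) + poly_length Q * poly_length (pderiv P)"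
      by (intro add_mono poly_length_mult)
    also have "\<dots> \<le> poly_length P * (n * poly_length Q) + poly_length Q * (n * poly_length P)"
      using PQ by (intro add_mono mult_left_mono poly_length_pderiv) auto
    finally have "of_int q0 ^ i \<le> 2 * real n * (poly_length P * poly_length Q) + 1" by (simp add: algebra_simps)
    then show ?thesis using q(2) Suc by simp
  qed
qed

text \<open>
The core of Thue's argument. With \<open>x = p\<^sub>0 / q\<^sub>0\<close>, \<open>y = p\<^sub>1 / q\<^sub>1\<close> and \<open>F = q\<^sub>1 P - p\<^sub>1 Q\<close>, the first
nonzero Taylor coefficient of \<open>F\<close> at \<open>x\<close> is at least \<open>1\<close> divided by the \<open>8 k\<close>-th power of \<open>q\<^sub>0\<close>. For the
upper bound, \<open>F = q\<^sub>1 (P - \<theta> Q) + q\<^sub>1 (\<theta> - y) Q\<close>, where the first term is small since \<open>x\<close> is close to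
\<open>\<theta>\<close> and the second since \<open>y\<close> is. The two terms give the two summands of the conclusion.
\<close>

lemma two_approximations_inequality:
  fixes p0 q0 p1 q1 :: int
  assumes PQ: "int_coeffs P" "int_coeffs Q" "degree P \<le> 8 * k" "degree Q \<le> 8 * k"
      "poly_length P \<le> C ^ k" "poly_length Q \<le> C ^ k"
    and W: "wronskian P Q \<noteq> 0" and van: "[:- \<theta>, 1:] ^ (3 * k) dvd P - smult \<theta> Q"
    and C: "C \<ge> 1" and c: "c \<ge> 1" and k: "k \<ge> 1"
    and x0: "coprime p0 q0" "q0 > 0" "\<bar>\<theta> - of_int p0 / of_int q0\<bar> \<le> c / of_int q0 ^ 4"
        "\<bar>\<theta> - of_int p0 / of_int q0\<bar> \<le> 1"
    and x1: "q1 > 0" "\<bar>\<theta> - of_int p1 / of_int q1\<bar> \<le> c / of_int q1 ^ 4"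
  defines "E \<equiv> 2 ^ 11 * C * (2 + \<bar>\<theta>\<bar>) ^ 9"
  defines "K \<equiv> c ^ 3 * (17 * C\<^sup>2) ^ 4 * E"
  shows "1 \<le> K ^ k * (of_int q1 * of_int q0 ^ 4 / of_int q0 ^ (4 * k) + of_int q0 ^ (8 * k) / of_int q1 ^ 3)"
proof -
  define x y u v where "x = real_of_int p0 / of_int q0" and "y = real_of_int p1 / of_int q1"
    and "u = real_of_int q0" and "v = real_of_int q1"
  have u: "u \<ge> 1" and v: "v \<ge> 1" using x0 x1 by (auto simp: u_def v_def)
  define F where "F = smult (of_int q1) P - smult (of_int p1) Q"
  define j where "j = order x F"
  have v0: "real_of_int q1 \<noteq> 0" using x1 by simp
  note idx = order_at_fraction_bounded_by_wronskian[OF PQ(1-4) W x0(1,2) v0, of "of_int p1", folded F_def x_def, folded j_def]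
  have uj: "u ^ j \<le> u * (17 * C\<^sup>2) ^ k"
  proof -
    have "poly_length P * poly_length Q \<le> C ^ k * C ^ k" using C by (intro mult_mono PQ) auto
    also have "\<dots> = (C\<^sup>2) ^ k" by (simp add: power2_eq_square power_mult_distrib)
    finally have "2 * real (8 * k) * (poly_length P * poly_length Q) + 1 \<le> real (16 * k) * (C\<^sup>2) ^ k + (C\<^sup>2) ^ k"
      using C by (intro add_mono) (auto intro: mult_left_mono one_le_power)
    also have "\<dots> = real (1 + k * 16) * (C\<^sup>2) ^ k" by (simp add: algebra_simps)
    also have "\<dots> \<le> 17 ^ k * (C\<^sup>2) ^ k"
      using Bernoulli_inequality[of 16 k] by (intro mult_right_mono) auto
    finally have "2 * real (8 * k) * (poly_length P * poly_length Q) + 1 \<le> (17 * C\<^sup>2) ^ k"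
      by (simp add: power_mult_distrib)
    then have "u * (2 * real (8 * k) * (poly_length P * poly_length Q) + 1) \<le> u * (17 * C\<^sup>2) ^ k"
      using u by (intro mult_left_mono) auto
    then show ?thesis using idx(2) unfolding u_def by linarith
  qed
  have "int_coeffs F" unfolding F_def by (intro int_coeffs_diff int_coeffs_smult PQ) auto
  moreover have degF: "degree F \<le> 8 * k"
    unfolding F_def using PQ(3,4) by (intro degree_diff_le) (auto intro: order_trans[OF degree_smult_le])
  ultimately have "u ^ (8 * k) * coeff (F \<circ>\<^sub>p [:x, 1:]) j \<in> \<int>"
    unfolding u_def x_def using x0(2) by (intro Ints_denominator_power_mult_coeff_shift)
  moreover have "coeff (F \<circ>\<^sub>p [:x, 1:]) j \<noteq> 0"
  proof
    assume "coeff (F \<circ>\<^sub>p [:x, 1:]) j = 0"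
    moreover have "\<forall>i<j. coeff (F \<circ>\<^sub>p [:x, 1:]) i = 0"
      unfolding coeff_shift_eq_0_iff j_def by (rule order_1)
    ultimately have "[:- x, 1:] ^ Suc j dvd F"
      unfolding coeff_shift_eq_0_iff[symmetric] by (auto simp: less_Suc_eq)
    then show False using order_2[OF idx(1)] by (simp add: j_def)
  qed
  ultimately have "1 \<le> \<bar>u ^ (8 * k) * coeff (F \<circ>\<^sub>p [:x, 1:]) j\<bar>"
    using u by (intro Ints_nonzero_abs_ge1) auto
  then have lower: "1 \<le> u ^ (8 * k) * \<bar>coeff (F \<circ>\<^sub>p [:x, 1:]) j\<bar>" using u by (simp add: abs_mult)
  define S where "S = P - smult \<theta> Q"
  have "F = smult v S + smult (v * \<theta> - of_int p1) Q"
    by (simp add: F_def S_def v_def smult_diff_right smult_diff_left)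
  then have "coeff (F \<circ>\<^sub>p [:x, 1:]) j = v * coeff (S \<circ>\<^sub>p [:x, 1:]) j + (v * \<theta> - of_int p1) * coeff (Q \<circ>\<^sub>p [:x, 1:]) j"
    by (simp add: pcompose_add pcompose_smult)
  moreover have "v * \<theta> - of_int p1 = v * (\<theta> - y)" using v by (simp add: y_def v_def algebra_simps)
  ultimately have split: "\<bar>coeff (F \<circ>\<^sub>p [:x, 1:]) j\<bar>
      \<le> v * \<bar>coeff (S \<circ>\<^sub>p [:x, 1:]) j\<bar> + v * \<bar>\<theta> - y\<bar> * \<bar>coeff (Q \<circ>\<^sub>p [:x, 1:]) j\<bar>"
    using v abs_triangle_ineq[of "v * coeff (S \<circ>\<^sub>p [:x, 1:]) j" "v * (\<theta> - y) * coeff (Q \<circ>\<^sub>p [:x, 1:]) j"]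
    by (simp add: abs_mult)
  have dx: "\<bar>x - \<theta>\<bar> \<le> c / u ^ 4" "\<bar>x - \<theta>\<bar> \<le> 1"
    using x0(3,4) by (simp_all add: x_def u_def abs_minus_commute)
  have dy: "\<bar>\<theta> - y\<bar> \<le> c / v ^ 4" using x1(2) by (simp add: y_def v_def)
  define t where "t = 2 + \<bar>\<theta>\<bar>"
  have t: "t \<ge> 2" by (simp add: t_def)
  have E_pow: "E ^ k = 2 ^ (11 * k) * C ^ k * t ^ (9 * k)"
    unfolding E_def t_def power_mult_distrib power_mult ..
  have coeff_Q: "\<bar>coeff (Q \<circ>\<^sub>p [:x, 1:]) j\<bar> \<le> E ^ k"
  proof -
    have "\<bar>coeff (Q \<circ>\<^sub>p [:x, 1:]) j\<bar> \<le> poly_length (Q \<circ>\<^sub>p [:x, 1:])" by (rule abs_coeff_le_poly_length)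
    also have "\<dots> \<le> poly_length Q * t ^ (8 * k)"
      using dx(2) PQ(4) by (intro poly_length_pcompose) (auto simp: t_def)
    also have "\<dots> \<le> (2 ^ (11 * k) * C ^ k) * t ^ (9 * k)"
    proof (intro mult_mono)
      have "1 * C ^ k \<le> 2 ^ (11 * k) * C ^ k" using C by (intro mult_right_mono) auto
      then show "poly_length Q \<le> 2 ^ (11 * k) * C ^ k" using PQ(6) by simp
    qed (use t C in \<open>auto intro: power_increasing\<close>)
    finally show ?thesis unfolding E_pow .
  qed
  have coeff_S: "\<bar>coeff (S \<circ>\<^sub>p [:x, 1:]) j\<bar> \<le> \<bar>x - \<theta>\<bar> ^ (3 * k - j) * E ^ k"
  proof -
    have "degree S \<le> 8 * k"
      unfolding S_def using PQ(3,4) by (intro degree_diff_le) (auto intro: order_trans[OF degree_smult_le])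
    then have "\<bar>coeff (S \<circ>\<^sub>p [:x, 1:]) j\<bar>
        \<le> \<bar>x - \<theta>\<bar> ^ (3 * k - j) * (2 ^ (3 * k) * (2 ^ (8 * k) * (poly_length S * (1 + \<bar>\<theta>\<bar>) ^ (8 * k))))"
      using van dx(2) unfolding S_def by (intro abs_coeff_shift_near_high_order_root)
    also have "\<dots> \<le> \<bar>x - \<theta>\<bar> ^ (3 * k - j) * E ^ k"
    proof (intro mult_left_mono)
      have "poly_length S \<le> poly_length P + \<bar>\<theta>\<bar> * poly_length Q"
        unfolding S_def using poly_length_diff[of P "smult \<theta> Q"] by simp
      also have "\<dots> \<le> C ^ k + \<bar>\<theta>\<bar> * C ^ k" using PQ by (intro add_mono mult_left_mono) auto
      also have "\<dots> \<le> C ^ k * t" using C by (simp add: t_def algebra_simps)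
      finally have "poly_length S * (1 + \<bar>\<theta>\<bar>) ^ (8 * k) \<le> C ^ k * t * t ^ (8 * k)"
        using C t by (intro mult_mono power_mono) (auto simp: t_def)
      also have "\<dots> = C ^ k * t ^ (8 * k + 1)" by simp
      also have "\<dots> \<le> C ^ k * t ^ (9 * k)"
        using C t k by (intro mult_left_mono power_increasing) auto
      finally have "2 ^ (3 * k) * (2 ^ (8 * k) * (poly_length S * (1 + \<bar>\<theta>\<bar>) ^ (8 * k)))
          \<le> 2 ^ (3 * k) * (2 ^ (8 * k) * (C ^ k * t ^ (9 * k)))" by (intro mult_left_mono) auto
      also have "\<dots> = 2 ^ (3 * k + 8 * k) * C ^ k * t ^ (9 * k)" by (simp only: power_add mult.assoc)
      also have "3 * k + 8 * k = 11 * k" by simp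
      finally show "2 ^ (3 * k) * (2 ^ (8 * k) * (poly_length S * (1 + \<bar>\<theta>\<bar>) ^ (8 * k))) \<le> E ^ k"
        unfolding E_pow .
    qed simp
    finally show ?thesis .
  qed
  have E1: "E \<ge> 1" and E0: "E > 0"
  proof -
    have "1 * 1 * 1 \<le> 2 ^ 11 * C * t ^ 9" using C t by (intro mult_mono one_le_power) auto
    then show "E \<ge> 1" by (simp add: E_def t_def)
    then show "E > 0" by simp
  qed
  define M where "M = 17 * C\<^sup>2"
  have M1: "M \<ge> 1" using one_le_power[OF C, of 2] by (simp add: M_def)
  \<comment> \<open>Since \<open>j\<close> is controlled by \<open>uj\<close>, the loss \<open>u\<close> to the power \<open>4 j\<close> costs only \<open>u\<^sup>4\<close> and a factor
    absorbed by \<open>K\<^sup>k\<close>.\<close>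
  have small: "\<bar>x - \<theta>\<bar> ^ (3 * k - j) \<le> c ^ (3 * k) * u ^ 4 * M ^ (4 * k) / u ^ (12 * k)"
  proof -
    have "\<bar>x - \<theta>\<bar> ^ (3 * k - j) \<le> (c / u ^ 4) ^ (3 * k - j)" using dx by (intro power_mono) auto
    also have "\<dots> = c ^ (3 * k - j) / u ^ (4 * (3 * k - j))" by (simp add: power_divide power_mult)
    also have "\<dots> \<le> c ^ (3 * k) / u ^ (4 * (3 * k - j))"
      using c u by (intro divide_right_mono power_increasing) auto
    also have "\<dots> \<le> c ^ (3 * k) * u ^ (4 * j) / u ^ (12 * k)"
    proof -
      have "u ^ (12 * k) \<le> u ^ (4 * j + 4 * (3 * k - j))" using u by (intro power_increasing) auto
      then have "c ^ (3 * k) * u ^ (12 * k) \<le> c ^ (3 * k) * (u ^ (4 * j) * u ^ (4 * (3 * k - j)))"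
        using c by (intro mult_left_mono) (auto simp: power_add)
      then show ?thesis using u by (simp add: field_simps)
    qed
    also have "\<dots> \<le> c ^ (3 * k) * (u ^ 4 * M ^ (4 * k)) / u ^ (12 * k)"
    proof (intro divide_right_mono mult_left_mono)
      have "(u ^ j) ^ 4 \<le> (u * M ^ k) ^ 4" using uj u by (intro power_mono) (auto simp: M_def)
      then show "u ^ (4 * j) \<le> u ^ 4 * M ^ (4 * k)" by (simp add: power_mult_distrib mult.commute flip: power_mult)
    qed (use c u in auto)
    finally show ?thesis by (simp add: mult.assoc)
  qed
  have K_pow: "K ^ k = c ^ (3 * k) * M ^ (4 * k) * E ^ k"
    unfolding K_def M_def[symmetric] power_mult_distrib power_mult ..
  have "c * E ^ k \<le> K ^ k"
  proof -
    have "c ^ 1 * 1 * E ^ k \<le> c ^ (3 * k) * M ^ (4 * k) * E ^ k"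
      using c k M1 E0 E1 by (intro mult_mono power_increasing one_le_power) auto
    then show ?thesis by (simp add: K_pow)
  qed
  have term1: "v * \<bar>coeff (S \<circ>\<^sub>p [:x, 1:]) j\<bar> \<le> K ^ k * (v * u ^ 4 / u ^ (12 * k))"
  proof -
    have "v * \<bar>coeff (S \<circ>\<^sub>p [:x, 1:]) j\<bar> \<le> v * (c ^ (3 * k) * u ^ 4 * M ^ (4 * k) / u ^ (12 * k) * E ^ k)"
      using v E0 by (intro mult_left_mono order_trans[OF coeff_S] mult_right_mono small) auto
    then show ?thesis by (simp add: K_pow mult_ac)
  qed
  have term2: "v * \<bar>\<theta> - y\<bar> * \<bar>coeff (Q \<circ>\<^sub>p [:x, 1:]) j\<bar> \<le> K ^ k * (1 / v ^ 3)"
  proof -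
    have "v * \<bar>\<theta> - y\<bar> * \<bar>coeff (Q \<circ>\<^sub>p [:x, 1:]) j\<bar> \<le> v * (c / v ^ 4) * E ^ k"
      using coeff_Q dy v c by (intro mult_mono) auto
    also have "\<dots> = (c * E ^ k) * (1 / v ^ 3)" using v by (simp add: field_simps power4_eq_xxxx power3_eq_cube)
    also have "\<dots> \<le> K ^ k * (1 / v ^ 3)" using \<open>c * E ^ k \<le> K ^ k\<close> v by (intro mult_right_mono) auto
    finally show ?thesis .
  qed
  have "\<bar>coeff (F \<circ>\<^sub>p [:x, 1:]) j\<bar> \<le> K ^ k * (v * u ^ 4 / u ^ (12 * k)) + K ^ k * (1 / v ^ 3)"
    using split term1 term2 by linarith
  then have "u ^ (8 * k) * \<bar>coeff (F \<circ>\<^sub>p [:x, 1:]) j\<bar>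
      \<le> u ^ (8 * k) * (K ^ k * (v * u ^ 4 / u ^ (12 * k)) + K ^ k * (1 / v ^ 3))"
    using u by (intro mult_left_mono) auto
  with lower have "1 \<le> u ^ (8 * k) * (K ^ k * (v * u ^ 4 / u ^ (12 * k)) + K ^ k * (1 / v ^ 3))"
    by linarith
  also have "\<dots> = K ^ k * (u ^ (8 * k) * (v * u ^ 4 / u ^ (12 * k)) + u ^ (8 * k) / v ^ 3)"
    by (simp add: algebra_simps)
  also have "u ^ (8 * k) * (v * u ^ 4 / u ^ (12 * k)) = v * u ^ 4 / u ^ (4 * k)"
  proof -
    have "u ^ (12 * k) = u ^ (8 * k) * u ^ (4 * k)" by (simp flip: power_add)
    then show ?thesis using u by simp
  qed
  finally show ?thesis unfolding u_def v_def .
qed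

lemma finite_fractions_bounded_denominator:
  fixes \<theta> c N :: real
  shows "finite {(p::int, q::int). 0 < q \<and> of_int q \<le> N \<and> \<bar>\<theta> - of_int p / of_int q\<bar> \<le> c}"
proof -
  define M where "M = \<lceil>\<bar>N\<bar> * (\<bar>\<theta>\<bar> + \<bar>c\<bar>)\<rceil>"
  have "\<bar>p\<bar> \<le> M \<and> q \<le> \<lfloor>N\<rfloor>" if "0 < q" "of_int q \<le> N" "\<bar>\<theta> - of_int p / of_int q\<bar> \<le> c" for p q :: int
  proof -
    have "\<bar>of_int p / real_of_int q\<bar> \<le> \<bar>\<theta>\<bar> + \<bar>c\<bar>" using that(3) by linarith
    then have "\<bar>real_of_int p\<bar> \<le> of_int q * (\<bar>\<theta>\<bar> + \<bar>c\<bar>)" using that(1) by (simp add: field_simps)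
    also have "\<dots> \<le> \<bar>N\<bar> * (\<bar>\<theta>\<bar> + \<bar>c\<bar>)" using that by (intro mult_right_mono) auto
    finally show ?thesis using that(2) unfolding M_def by (simp add: le_floor_iff) linarith
  qed
  then have "{(p, q). 0 < q \<and> of_int q \<le> N \<and> \<bar>\<theta> - of_int p / of_int q\<bar> \<le> c} \<subseteq> {- M..M} \<times> {0..\<lfloor>N\<rfloor>}"
    by force
  then show ?thesis by (rule finite_subset) simp
qed

section \<open>Finiteness of the approximations\<close>

definition approximations :: "real \<Rightarrow> real \<Rightarrow> (int \<times> int) set" where
  "approximations \<theta> c = {(p, q). coprime p q \<and> 0 < q \<and> \<bar>\<theta> - of_int p / of_int q\<bar> \<le> c / of_int q ^ 4}"

lemma approximations_mono: "c \<le> d \<Longrightarrow> approximations \<theta> c \<subseteq> approximations \<theta> d"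
  unfolding approximations_def by (auto elim!: order_trans intro!: divide_right_mono)

lemma finite_approximations_bounded_denominator:
  assumes "c \<ge> 0"
  shows "finite {(p, q) \<in> approximations \<theta> c. of_int q \<le> (N::real)}"
proof (rule finite_subset[OF _ finite_fractions_bounded_denominator])
  have "c / of_int q ^ 4 \<le> c" if "q > 0" for q :: int
  proof -
    have "1 \<le> real_of_int q ^ 4" using that by (intro one_le_power) simp
    then show ?thesis using assms by (simp add: divide_le_eq mult_le_cancel_left1)
  qed
  then show "{(p, q) \<in> approximations \<theta> c. of_int q \<le> N}
      \<subseteq> {(p, q). 0 < q \<and> of_int q \<le> N \<and> \<bar>\<theta> - of_int p / of_int q\<bar> \<le> c}"
    by (force simp: approximations_def)
qed

lemma infinite_approximations_large_denominator:
  assumes "infinite (approximations \<theta> c)" "c \<ge> 0"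
  obtains p q where "(p, q) \<in> approximations \<theta> c" "of_int q > (N::real)"
proof -
  have "\<not> approximations \<theta> c \<subseteq> {(p, q) \<in> approximations \<theta> c. of_int q \<le> N}"
    using assms finite_approximations_bounded_denominator[of c \<theta> N] finite_subset by blast
  then show thesis using that by force
qed

text \<open>
From infinitely many approximations one picks \<open>q\<^sub>0\<close> large in terms of the constant \<open>K\<close> of
\<open>two_approximations_inequality\<close>, and then \<open>q\<^sub>1\<close> large in terms of \<open>q\<^sub>0\<close>. When \<open>q\<^sub>1\<close> lies between the
powers \<open>3 k\<close> and \<open>3 k + 3\<close> of \<open>q\<^sub>0\<close>, both summands of that inequality are at most \<open>q\<^sub>0\<^sup>7\<close> divided by the
\<open>k\<close>-th power of \<open>q\<^sub>0\<close>, which beats \<open>K\<^sup>k\<close> as soon as \<open>k \<ge> 8\<close>.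
\<close>

lemma finite_approximations_min_degree_4:
  assumes min: "\<And>h. int_coeffs h \<Longrightarrow> h \<noteq> 0 \<Longrightarrow> poly h \<theta> = 0 \<Longrightarrow> 4 \<le> degree h"
    and g: "int_coeffs g" "degree g = 4" "poly g \<theta> = 0" and c: "c \<ge> 1"
  shows "finite (approximations \<theta> c)"
proof (rule ccontr)
  assume inf: "infinite (approximations \<theta> c)"
  obtain C where C: "C \<ge> 1" and aux: "\<And>k. k \<ge> 1 \<Longrightarrow> \<exists>P Q. int_coeffs P \<and> int_coeffs Q \<and> (P \<noteq> 0 \<or> Q \<noteq> 0)
           \<and> degree P \<le> 8 * k \<and> degree Q \<le> 8 * k \<and> poly_length P \<le> C ^ k \<and> poly_length Q \<le> C ^ k
           \<and> [:- \<theta>, 1:] ^ (3 * k) dvd P - smult \<theta> Q"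
    using auxiliary_polynomials[OF g] by blast
  define K where "K = c ^ 3 * (17 * C\<^sup>2) ^ 4 * (2 ^ 11 * C * (2 + \<bar>\<theta>\<bar>) ^ 9)"
  have K: "K \<ge> 1"
  proof -
    have "1 \<le> 17 * C\<^sup>2" using one_le_power[OF C, of 2] by simp
    then have "1 \<le> (17 * C\<^sup>2) ^ 4" by (rule one_le_power)
    then have "1 * 1 * (1 * 1 * 1) \<le> K" unfolding K_def using C c by (intro mult_mono) (auto intro: one_le_power)
    then show ?thesis by simp
  qed
  obtain p0 q0 where x0: "(p0, q0) \<in> approximations \<theta> c" "of_int q0 > (3 * K) ^ 8 + c"
    using infinite_approximations_large_denominator[OF inf] c by (metis order_trans zero_le_one)
  define u where "u = real_of_int q0"
  have uK: "u \<ge> (3 * K) ^ 8" and uc: "u \<ge> c" using x0(2) c K unfolding u_def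
    by (smt (verit) zero_le_power)+
  have u2: "u \<ge> 2"
  proof -
    have "(3::real) ^ 1 \<le> (3 * K) ^ 1" using K by simp
    also have "\<dots> \<le> (3 * K) ^ 8" using K by (intro power_increasing) auto
    finally show ?thesis using uK by simp
  qed
  \<comment> \<open>The exponent \<open>24 = 3 \<cdot> 8\<close> makes \<open>k \<ge> 8\<close> below.\<close>
  obtain p1 q1 where x1: "(p1, q1) \<in> approximations \<theta> c" "of_int q1 > u ^ 24"
    using infinite_approximations_large_denominator[OF inf] c by (metis order_trans zero_le_one)
  define v where "v = real_of_int q1"
  have v0: "v > 0" using x1(1) by (simp add: v_def approximations_def)
  have v24: "u ^ (3 * 8) \<le> v" using x1(2) by (simp add: v_def)
  obtain n where n: "v < u ^ n" using real_arch_pow[of u v] u2 by auto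
  have bound: "k \<le> n" if "u ^ (3 * k) \<le> v" for k
  proof (rule ccontr)
    assume "\<not> k \<le> n"
    then have "u ^ n \<le> u ^ (3 * k)" using u2 by (intro power_increasing) auto
    then show False using that n by simp
  qed
  define k where "k = (GREATEST k. u ^ (3 * k) \<le> v)"
  have k1: "u ^ (3 * k) \<le> v" unfolding k_def 
    by (rule GreatestI_nat[where k = 8 and b = n]) (use v24 bound in auto)
  have k8: "k \<ge> 8" unfolding k_def 
    by (rule Greatest_le_nat[where b = n]) (use v24 bound in auto)
  have k2: "v < u ^ (3 * Suc k)"
  proof (rule ccontr)
    assume "\<not> v < u ^ (3 * Suc k)"
    then have "Suc k \<le> k" unfolding k_def by (intro Greatest_le_nat[where b = n]) (use bound in auto)
    then show False by simp
  qed
  obtain P Q where PQ: "int_coeffs P" "int_coeffs Q" "P \<noteq> 0 \<or> Q \<noteq> 0"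
      "degree P \<le> 8 * k" "degree Q \<le> 8 * k" "poly_length P \<le> C ^ k" "poly_length Q \<le> C ^ k"
    and van: "[:- \<theta>, 1:] ^ (3 * k) dvd P - smult \<theta> Q"
    using aux[of k] k8 by auto
  have W: "wronskian P Q \<noteq> 0"
    using k8 by (intro wronskian_nonzero[OF min g PQ(1-5) _ van]) auto
  have near: "\<bar>\<theta> - of_int p0 / of_int q0\<bar> \<le> 1"
  proof -
    have "u \<le> u ^ 4" using u2 power_increasing[of 1 4 u] by simp
    then have "c / u ^ 4 \<le> 1" using uc u2 by (simp add: divide_le_eq)
    moreover have "\<bar>\<theta> - of_int p0 / of_int q0\<bar> \<le> c / u ^ 4"
      using x0(1) by (simp add: approximations_def u_def)
    ultimately show ?thesis by simp
  qed
  have "1 \<le> K ^ k * (v * u ^ 4 / u ^ (4 * k) + u ^ (8 * k) / v ^ 3)"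
    using x0(1) x1(1) k8 near unfolding K_def u_def v_def approximations_def
    by (intro two_approximations_inequality[OF PQ(1,2,4-7) W van C c]) auto
  also have "\<dots> \<le> K ^ k * (u ^ 7 / u ^ k + 1 / u ^ k)"
  proof (intro mult_left_mono add_mono)
    have "v * u ^ 4 \<le> u ^ (3 * Suc k) * u ^ 4" using k2 u2 by (intro mult_right_mono) auto
    also have "\<dots> = u ^ (7 + 3 * k)" by (simp flip: power_add)
    finally have "v * u ^ 4 / u ^ (4 * k) \<le> u ^ (7 + 3 * k) / u ^ (4 * k)"
      using u2 by (intro divide_right_mono) auto
    also have "\<dots> = u ^ 7 / u ^ k"
    proof -
      have "u ^ (4 * k) = u ^ k * u ^ (3 * k)" by (simp flip: power_add)
      then show ?thesis using u2 by (simp add: power_add)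
    qed
    finally show "v * u ^ 4 / u ^ (4 * k) \<le> u ^ 7 / u ^ k" .
    have "u ^ (9 * k) = (u ^ (3 * k)) ^ 3" by (simp flip: power_mult)
    also have "\<dots> \<le> v ^ 3" using k1 u2 by (intro power_mono) auto
    finally have "u ^ (8 * k) / v ^ 3 \<le> u ^ (8 * k) / u ^ (9 * k)"
      using u2 v0 by (intro divide_left_mono) auto
    also have "u ^ (9 * k) = u ^ (8 * k) * u ^ k" by (simp flip: power_add)
    finally show "u ^ (8 * k) / v ^ 3 \<le> 1 / u ^ k" using u2 by simp
  qed (use K in auto)
  also have "\<dots> \<le> K ^ k * (2 * (u ^ 7 / u ^ k))"
  proof (intro mult_left_mono)
    have "1 / u ^ k \<le> u ^ 7 / u ^ k" using u2 by (intro divide_right_mono one_le_power) auto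
    then show "u ^ 7 / u ^ k + 1 / u ^ k \<le> 2 * (u ^ 7 / u ^ k)" by simp
  qed (use K in auto)
  also have "\<dots> < 1"
  proof -
    \<comment> \<open>\<open>k \<le> 8 (k - 7)\<close> holds exactly for \<open>k \<ge> 8\<close>, which is why \<open>q\<^sub>0\<close> was compared with the eighth power
      of \<open>3 K\<close>.\<close>
    have "(3 * K) ^ k \<le> (3 * K) ^ (8 * (k - 7))" using K k8 by (intro power_increasing) auto
    also have "\<dots> = ((3 * K) ^ 8) ^ (k - 7)" by (rule power_mult)
    also have "\<dots> \<le> u ^ (k - 7)" using uK K by (intro power_mono) auto
    finally have le: "3 ^ k * K ^ k \<le> u ^ (k - 7)" by (simp add: power_mult_distrib)
    have "2 * K ^ k < 3 ^ k * K ^ k"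
    proof (intro mult_strict_right_mono)
      have "(3::real) ^ 1 \<le> 3 ^ k" using k8 by (intro power_increasing) auto
      then show "(2::real) < 3 ^ k" by simp
    qed (use K in auto)
    then have "2 * K ^ k < u ^ (k - 7)" using le by simp
    then have "2 * K ^ k * u ^ 7 < u ^ (k - 7) * u ^ 7" using u2 by (intro mult_strict_right_mono) auto
    also have "\<dots> = u ^ k" using k8 by (simp flip: power_add)
    finally show ?thesis using u2 by (simp add: field_simps)
  qed
  finally show False by simp
qed

text \<open>
Liouville's inequality: \<open>g(p / q)\<close> is either zero, which leaves finitely many fractions, or at least
\<open>1 / q\<^sup>3\<close>, while the factor \<open>x - \<theta>\<close> of \<open>g\<close> makes it at most a constant times \<open>c / q\<^sup>4\<close>.
\<close>

lemma finite_approximations_degree_le_3: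
  assumes g: "int_coeffs g" "g \<noteq> 0" "degree g \<le> 3" "poly g \<theta> = 0" and c: "c \<ge> 0"
  shows "finite (approximations \<theta> c)"
proof -
  obtain h where h: "g = [:- \<theta>, 1:] * h" using g(4) by (auto simp: poly_eq_0_iff_dvd)
  have "compact (poly h ` {\<theta> - c..\<theta> + c})"
    by (intro compact_continuous_image continuous_intros) auto
  then have "bounded (poly h ` {\<theta> - c..\<theta> + c})" by (rule compact_imp_bounded)
  then obtain B where B: "\<And>x. x \<in> {\<theta> - c..\<theta> + c} \<Longrightarrow> \<bar>poly h x\<bar> \<le> B"
    unfolding bounded_iff by (metis imageI real_norm_def)
  define Z where "Z = {(p::int, q::int). coprime p q \<and> 0 < q \<and> poly g (of_int p / of_int q) = 0}"
  have "inj_on (\<lambda>(p, q). real_of_int p / of_int q) Z"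
  proof (rule inj_onI)
    fix s t assume "s \<in> Z" "t \<in> Z" and eq: "(case s of (p, q) \<Rightarrow> real_of_int p / of_int q) = (case t of (p, q) \<Rightarrow> real_of_int p / of_int q)"
    then obtain p q p' q' where st: "s = (p, q)" "t = (p', q')"
      and pq: "coprime p q" "0 < q" "coprime p' q'" "0 < q'" by (auto simp: Z_def)
    have "real_of_int (p * q') = of_int (p' * q)" using eq pq by (simp add: st field_simps)
    then have *: "p * q' = p' * q" by linarith
    then have "q dvd p * q'" "q' dvd p' * q" by (metis dvd_triv_right)+
    moreover have "coprime q p" "coprime q' p'" using pq by (simp_all add: coprime_commute)
    ultimately have "q dvd q'" "q' dvd q" by (simp_all add: coprime_dvd_mult_right_iff)
    then have "q = q'" using pq by (simp add: zdvd_antisym_nonneg)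
    then show "s = t" using * pq by (simp add: st)
  qed
  moreover have "(\<lambda>(p, q). real_of_int p / of_int q) ` Z \<subseteq> {x. poly g x = 0}" by (auto simp: Z_def)
  ultimately have "finite Z" using poly_roots_finite[OF g(2)] finite_subset finite_imageD by blast
  moreover have "approximations \<theta> c \<subseteq> Z \<union> {(p, q) \<in> approximations \<theta> c. of_int q \<le> c * B}"
  proof clarsimp
    fix p q assume pq: "(p, q) \<in> approximations \<theta> c" "(p, q) \<notin> Z"
    define x where "x = real_of_int p / of_int q"
    have q: "q > 0" "1 \<le> real_of_int q" and x: "\<bar>\<theta> - x\<bar> \<le> c / of_int q ^ 4" and nz: "poly g x \<noteq> 0"
      using pq by (auto simp: approximations_def Z_def x_def)
    have "c / of_int q ^ 4 \<le> c" using q(2) c by (simp add: divide_le_eq mult_le_cancel_left1 one_le_power)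
    then have "x \<in> {\<theta> - c..\<theta> + c}" using x by auto
    then have hB: "\<bar>poly h x\<bar> \<le> B" by (rule B)
    have gx: "poly g x = (x - \<theta>) * poly h x" by (simp add: h algebra_simps)
    have "coeff (g \<circ>\<^sub>p [:x, 1:]) 0 = poly g x" by (simp add: pcompose_coeff_0)
    then have "of_int q ^ 3 * poly g x \<in> \<int>"
      using Ints_denominator_power_mult_coeff_shift[OF g(1,3) q(1), of p 0] by (simp add: x_def)
    then have "1 \<le> \<bar>of_int q ^ 3 * poly g x\<bar>" using nz q by (intro Ints_nonzero_abs_ge1) auto
    also have "\<dots> = of_int q ^ 3 * (\<bar>\<theta> - x\<bar> * \<bar>poly h x\<bar>)"
      using q by (simp add: gx abs_mult abs_minus_commute)
    also have "\<dots> \<le> of_int q ^ 3 * (c / of_int q ^ 4 * B)"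
      using q x hB c by (intro mult_left_mono mult_mono) auto
    also have "\<dots> = c * B / of_int q" using q by (simp add: field_simps power4_eq_xxxx power3_eq_cube)
    finally show "of_int q \<le> c * B" using q by (simp add: field_simps)
  qed
  ultimately show ?thesis
    using finite_subset[OF _ finite_UnI[OF _ finite_approximations_bounded_denominator[OF c]]] by blast
qed

lemma finite_approximations_quartic:
  assumes f: "int_coeffs f" "f \<noteq> 0" "degree f \<le> 4" "poly f \<theta> = 0"
  shows "finite (approximations \<theta> c)"
proof -
  define d where "d = max c 1"
  define S where "S = {h. int_coeffs h \<and> h \<noteq> 0 \<and> poly h \<theta> = 0}"
  have "f \<in> S" using f by (simp add: S_def)
  then obtain g where g: "g \<in> S" and min: "\<And>h. h \<in> S \<Longrightarrow> degree g \<le> degree h"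
    using ex_has_least_nat[of "\<lambda>h. h \<in> S" f degree] by blast
  have "degree g \<le> 4" using min[OF \<open>f \<in> S\<close>] f(3) by simp
  have "finite (approximations \<theta> d)"
  proof (cases "degree g \<le> 3")
    case True
    then show ?thesis using g by (intro finite_approximations_degree_le_3[of g]) (auto simp: S_def d_def)
  next
    case False
    then have "degree g = 4" using \<open>degree g \<le> 4\<close> by simp
    then show ?thesis using g min by (intro finite_approximations_min_degree_4[of \<theta> g]) (auto simp: S_def d_def)
  qed
  then show ?thesis using approximations_mono[of c d \<theta>] finite_subset by (auto simp: d_def)
qed

section \<open>The resultant of two binary quadratic forms\<close>

text \<open>
The Leibniz formula, obtained by inserting one index after the other into the permutations.
\<close>

lemma det_4:
  "det (A::'a::comm_ring_1^4^4) =
    A$1$1 * A$2$2 * A$3$3 * A$4$4 - A$1$1 * A$2$2 * A$3$4 * A$4$3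
  - A$1$1 * A$2$3 * A$3$2 * A$4$4 + A$1$1 * A$2$3 * A$3$4 * A$4$2
  + A$1$1 * A$2$4 * A$3$2 * A$4$3 - A$1$1 * A$2$4 * A$3$3 * A$4$2
  - A$1$2 * A$2$1 * A$3$3 * A$4$4 + A$1$2 * A$2$1 * A$3$4 * A$4$3
  + A$1$2 * A$2$3 * A$3$1 * A$4$4 - A$1$2 * A$2$3 * A$3$4 * A$4$1
  - A$1$2 * A$2$4 * A$3$1 * A$4$3 + A$1$2 * A$2$4 * A$3$3 * A$4$1
  + A$1$3 * A$2$1 * A$3$2 * A$4$4 - A$1$3 * A$2$1 * A$3$4 * A$4$2
  - A$1$3 * A$2$2 * A$3$1 * A$4$4 + A$1$3 * A$2$2 * A$3$4 * A$4$1
  + A$1$3 * A$2$4 * A$3$1 * A$4$2 - A$1$3 * A$2$4 * A$3$2 * A$4$1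
  - A$1$4 * A$2$1 * A$3$2 * A$4$3 + A$1$4 * A$2$1 * A$3$3 * A$4$2
  + A$1$4 * A$2$2 * A$3$1 * A$4$3 - A$1$4 * A$2$2 * A$3$3 * A$4$1
  - A$1$4 * A$2$3 * A$3$1 * A$4$2 + A$1$4 * A$2$3 * A$3$2 * A$4$1"
proof -
  have f1234: "finite {2::4, 3, 4}" "1 \<notin> {2::4, 3, 4}" by auto
  have f234: "finite {3::4, 4}" "2 \<notin> {3::4, 4}" by auto
  have f34: "finite {4::4}" "3 \<notin> {4::4}" by auto
  show ?thesis
    unfolding det_def UNIV_4
    unfolding sum_over_permutations_insert[OF f1234]
    unfolding sum_over_permutations_insert[OF f234]
    unfolding sum_over_permutations_insert[OF f34]
    unfolding permutes_sing
    by (simp add: sign_swap_id permutation_swap_id permutation_compose sign_compose sign_id swap_id_eq algebra_simps)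
qed

lemma vector_4:
  "(vector [w, x, y, z] :: 'a::zero^4) $ 1 = w"
  "(vector [w, x, y, z] :: 'a::zero^4) $ 2 = x"
  "(vector [w, x, y, z] :: 'a::zero^4) $ 3 = y"
  "(vector [w, x, y, z] :: 'a::zero^4) $ 4 = z"
  unfolding vector_def by simp_all

lemma Res_eq:
  "Res (Quad_Form a b c) (Quad_Form a' b' c') = (a * c' - a' * c)\<^sup>2 - (a * b' - a' * b) * (b * c' - b' * c)"
  unfolding Res_def Res_matrix_def det_4 vector_4 quad_form.sel
  by (simp add: power2_eq_square algebra_simps)

text \<open>
The linear forms are read off from the adjugate of the Sylvester matrix. With \<open>p\<close>, \<open>q\<close>, \<open>r\<close> the three
\<open>2 \<times> 2\<close> minors of the coefficients, the resultant is \<open>q\<^sup>2 - p r\<close>.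
\<close>

lemma resultant_cofactors:
  fixes a b c a' b' c' x y :: "'a::comm_ring_1"
  defines "p \<equiv> a * b' - a' * b" and "q \<equiv> a * c' - a' * c" and "r \<equiv> b * c' - b' * c"
    and "f \<equiv> a * x\<^sup>2 + b * x * y + c * y\<^sup>2" and "g \<equiv> a' * x\<^sup>2 + b' * x * y + c' * y\<^sup>2"
  shows "(q\<^sup>2 - p * r) * x ^ 3 = ((q * c' - r * b') * x - r * c' * y) * f + ((r * b - q * c) * x + r * c * y) * g"
    and "(q\<^sup>2 - p * r) * y ^ 3 = (p * a' * x + (p * b' - q * a') * y) * f + ((q * a - p * b) * y - p * a * x) * g"
  unfolding p_def q_def r_def f_def g_def
  by (simp_all add: power2_eq_square power3_eq_cube algebra_simps)

lemma eval_form_cofactors: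
  fixes f g :: quad_form
  obtains \<alpha> \<beta> \<gamma> \<delta> \<alpha>' \<beta>' \<gamma>' \<delta>' :: int where
    "\<And>x y. Res f g * x ^ 3 = (\<alpha> * x + \<beta> * y) * eval_form f x y + (\<gamma> * x + \<delta> * y) * eval_form g x y"
    "\<And>x y. Res f g * y ^ 3 = (\<alpha>' * x + \<beta>' * y) * eval_form f x y + (\<gamma>' * x + \<delta>' * y) * eval_form g x y"
proof -
  obtain a b c a' b' c' where fg: "f = Quad_Form a b c" "g = Quad_Form a' b' c'" by (metis quad_form.exhaust)
  show thesis
    by (rule that[of "(a * c' - a' * c) * c' - (b * c' - b' * c) * b'" "- ((b * c' - b' * c) * c')"
        "(b * c' - b' * c) * b - (a * c' - a' * c) * c" "(b * c' - b' * c) * c"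
        "(a * b' - a' * b) * a'" "(a * b' - a' * b) * b' - (a * c' - a' * c) * a'"
        "- ((a * b' - a' * b) * a)" "(a * c' - a' * c) * a - (a * b' - a' * b) * b"])
      (simp_all add: fg Res_eq eval_form_def resultant_cofactors)
qed

lemma common_divisor_dvd_Res:
  assumes "coprime x y" "t dvd eval_form f x y" "t dvd eval_form g x y"
  shows "t dvd Res f g"
proof -
  obtain \<alpha> \<beta> \<gamma> \<delta> \<alpha>' \<beta>' \<gamma>' \<delta>' :: int where
    "Res f g * x ^ 3 = (\<alpha> * x + \<beta> * y) * eval_form f x y + (\<gamma> * x + \<delta> * y) * eval_form g x y"
    "Res f g * y ^ 3 = (\<alpha>' * x + \<beta>' * y) * eval_form f x y + (\<gamma>' * x + \<delta>' * y) * eval_form g x y"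
    by (metis eval_form_cofactors)
  then have "t dvd Res f g * x ^ 3" "t dvd Res f g * y ^ 3" using assms by simp_all
  then have "t dvd gcd (Res f g * x ^ 3) (Res f g * y ^ 3)" by (rule gcd_greatest)
  moreover have "gcd (x ^ 3) (y ^ 3) = 1" using assms(1) by simp
  ultimately show ?thesis by (simp add: gcd_mult_left)
qed

section \<open>Quartic Thue equations\<close>

text \<open>
Near a simple root the value of \<open>f\<close> is comparable to the distance from the root. The induction splits
off one root \<open>\<theta>\<close> at a time: no point can be close both to \<open>\<theta>\<close> and to a root of the cofactor, since these
have a positive distance.
\<close>

lemma distance_to_simple_roots:
  fixes f :: "real poly"
  assumes "\<And>x. poly f x = 0 \<Longrightarrow> poly (pderiv f) x \<noteq> 0" and "f \<noteq> 0"
  shows "\<exists>C>0. \<forall>t\<in>{-1..1}. 1 \<le> C * \<bar>poly f t\<bar> \<or> (\<exists>\<theta>. poly f \<theta> = 0 \<and> \<bar>\<theta> - t\<bar> \<le> C * \<bar>poly f t\<bar>)"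
  using assms
proof (induction "degree f" arbitrary: f rule: less_induct)
  case less
  show ?case
  proof (cases "\<exists>\<theta>. poly f \<theta> = 0")
    case False
    have "continuous_on {-1..1} (\<lambda>t. \<bar>poly f t\<bar>)" by (intro continuous_intros)
    then obtain s where s: "s \<in> {-1..1}" "\<And>t. t \<in> {-1..1} \<Longrightarrow> \<bar>poly f s\<bar> \<le> \<bar>poly f t\<bar>"
      using continuous_attains_inf[of "{-1..1::real}" "\<lambda>t. \<bar>poly f t\<bar>"] by auto
    have "\<bar>poly f s\<bar> > 0" using False by simp
    then show ?thesis using s(2)
      by (intro exI[of _ "1 / \<bar>poly f s\<bar>"]) (auto simp: field_simps)
  next
    case True
    then obtain \<theta> where \<theta>: "poly f \<theta> = 0" by blast
    then obtain h where h: "f = [:- \<theta>, 1:] * h" by (auto simp: poly_eq_0_iff_dvd)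
    have fh: "poly f x = (x - \<theta>) * poly h x" for x by (simp add: h algebra_simps)
    have f'h: "poly (pderiv f) x = (x - \<theta>) * poly (pderiv h) x + poly h x" for x
      unfolding h pderiv_mult by (simp add: pderiv_pCons algebra_simps)
    have h0: "h \<noteq> 0" using h less.prems(2) by auto
    have h\<theta>: "poly h \<theta> \<noteq> 0" using less.prems(1)[OF \<theta>] f'h[of \<theta>] by simp
    have "degree h < degree f" using h0 degree_mult_eq[of "[:- \<theta>, 1:]" h] by (simp add: h del: mult_pCons_left)
    moreover have "poly (pderiv h) x \<noteq> 0" if "poly h x = 0" for x
      using less.prems(1)[of x] that fh[of x] f'h[of x] by auto
    ultimately obtain C where C: "C > 0" and near: "\<And>t. t \<in> {-1..1} \<Longrightarrow>
        1 \<le> C * \<bar>poly h t\<bar> \<or> (\<exists>\<rho>. poly h \<rho> = 0 \<and> \<bar>\<rho> - t\<bar> \<le> C * \<bar>poly h t\<bar>)"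
      using less.hyps[of h] h0 by blast
    obtain s where s: "s > 0" and sep: "\<And>\<rho>. poly h \<rho> = 0 \<Longrightarrow> s \<le> \<bar>\<theta> - \<rho>\<bar>"
    proof (cases "{\<rho>. poly h \<rho> = 0} = {}")
      case True
      then show thesis using that[of 1] by auto
    next
      case False
      define D where "D = (\<lambda>\<rho>. \<bar>\<theta> - \<rho>\<bar>) ` {\<rho>. poly h \<rho> = 0}"
      have fin: "finite D" unfolding D_def using poly_roots_finite[OF h0] by simp
      have "D \<noteq> {}" using False by (simp add: D_def)
      then have "Min D \<in> D" using fin by (rule Min_in[rotated])
      then have "Min D > 0" using h\<theta> by (auto simp: D_def)
      moreover have "Min D \<le> \<bar>\<theta> - \<rho>\<bar>" if "poly h \<rho> = 0" for \<rho>
        using fin that by (intro Min_le) (auto simp: D_def)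
      ultimately show thesis using that by blast
    qed
    define C' where "C' = C + 2 * C / s"
    have C': "C' > 0" "C \<le> C'" "2 * C / s \<le> C'" using C s by (auto simp: C'_def add_pos_pos)
    have "1 \<le> C' * \<bar>poly f t\<bar> \<or> (\<exists>\<theta>. poly f \<theta> = 0 \<and> \<bar>\<theta> - t\<bar> \<le> C' * \<bar>poly f t\<bar>)" if t: "t \<in> {-1..1}" for t
      using near[OF t]
    proof
      assume "1 \<le> C * \<bar>poly h t\<bar>"
      then have "\<bar>\<theta> - t\<bar> * 1 \<le> \<bar>\<theta> - t\<bar> * (C * \<bar>poly h t\<bar>)" by (intro mult_left_mono) auto
      also have "\<dots> = C * \<bar>poly f t\<bar>" by (simp add: fh abs_mult abs_minus_commute)
      also have "\<dots> \<le> C' * \<bar>poly f t\<bar>" using C' by (intro mult_right_mono) auto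
      finally show ?thesis using \<theta> by auto
    next
      assume "\<exists>\<rho>. poly h \<rho> = 0 \<and> \<bar>\<rho> - t\<bar> \<le> C * \<bar>poly h t\<bar>"
      then obtain \<rho> where \<rho>: "poly h \<rho> = 0" "\<bar>\<rho> - t\<bar> \<le> C * \<bar>poly h t\<bar>" by blast
      have "\<bar>\<theta> - t\<bar> * \<bar>\<rho> - t\<bar> \<le> \<bar>\<theta> - t\<bar> * (C * \<bar>poly h t\<bar>)" using \<rho> by (intro mult_left_mono) auto
      also have "\<dots> = C * \<bar>poly f t\<bar>" by (simp add: fh abs_mult abs_minus_commute)
      finally have prod: "\<bar>\<theta> - t\<bar> * \<bar>\<rho> - t\<bar> \<le> C * \<bar>poly f t\<bar>" .
      have root: "poly f \<rho> = 0" using \<rho> by (simp add: fh)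
      have "s \<le> \<bar>\<theta> - t\<bar> + \<bar>\<rho> - t\<bar>" using sep[OF \<rho>(1)] by linarith
      then consider "s / 2 \<le> \<bar>\<theta> - t\<bar>" | "s / 2 \<le> \<bar>\<rho> - t\<bar>" by linarith
      then have "\<bar>\<rho> - t\<bar> \<le> 2 * C / s * \<bar>poly f t\<bar> \<or> \<bar>\<theta> - t\<bar> \<le> 2 * C / s * \<bar>poly f t\<bar>"
      proof cases
        case 1
        then have "s / 2 * \<bar>\<rho> - t\<bar> \<le> \<bar>\<theta> - t\<bar> * \<bar>\<rho> - t\<bar>" by (intro mult_right_mono) auto
        then show ?thesis using prod s by (simp add: field_simps)
      next
        case 2
        then have "\<bar>\<theta> - t\<bar> * (s / 2) \<le> \<bar>\<theta> - t\<bar> * \<bar>\<rho> - t\<bar>" by (intro mult_left_mono) auto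
        then show ?thesis using prod s by (simp add: field_simps)
      qed
      moreover have "2 * C / s * \<bar>poly f t\<bar> \<le> C' * \<bar>poly f t\<bar>" using C' by (intro mult_right_mono) auto
      ultimately show ?thesis using root \<theta> by (meson order_trans)
    qed
    then show ?thesis using C' by blast
  qed
qed

text \<open>
The value of \<open>f\<close> at \<open>a / b\<close> is \<open>h / b\<^sup>4\<close>, so either \<open>b\<close> is bounded or \<open>a / b\<close> is a very good approximation
of one of the roots of \<open>f\<close>.
\<close>

lemma finite_thue_positive_denominator:
  assumes f: "int_coeffs f" "f \<noteq> 0" "degree f \<le> 4"
    and simple: "\<And>x. poly f x = 0 \<Longrightarrow> poly (pderiv f) x \<noteq> 0"
  shows "finite {(a::int, b::int). coprime a b \<and> 0 < b \<and> \<bar>a\<bar> \<le> b \<and> of_int b ^ 4 * poly f (of_int a / of_int b) = h}"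
proof -
  obtain C where C: "C > 0" and near: "\<And>t. t \<in> {-1..1} \<Longrightarrow>
      1 \<le> C * \<bar>poly f t\<bar> \<or> (\<exists>\<theta>. poly f \<theta> = 0 \<and> \<bar>\<theta> - t\<bar> \<le> C * \<bar>poly f t\<bar>)"
    using distance_to_simple_roots[OF simple f(2)] by blast
  define c where "c = C * \<bar>h\<bar>"
  have cover: "(a, b) \<in> (\<Union>\<theta>\<in>{\<theta>. poly f \<theta> = 0}. approximations \<theta> c) \<union> {- \<lceil>c\<rceil>..\<lceil>c\<rceil>} \<times> {0..\<lceil>c\<rceil>}"
    if ab: "coprime a b" "0 < b" "\<bar>a\<bar> \<le> b" and h: "of_int b ^ 4 * poly f (of_int a / of_int b) = h" for a b :: int
  proof (rule UnCI)
    assume notin: "(a, b) \<notin> {- \<lceil>c\<rceil>..\<lceil>c\<rceil>} \<times> {0..\<lceil>c\<rceil>}"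
    define t where "t = real_of_int a / of_int b"
    have t: "t \<in> {-1..1}" using ab by (auto simp: t_def divide_simps abs_le_iff)
    have b1: "1 \<le> real_of_int b" using ab by simp
    have ft: "C * \<bar>poly f t\<bar> = c / of_int b ^ 4"
      unfolding c_def h[symmetric] t_def using ab by (simp add: abs_mult)
    have "\<not> 1 \<le> C * \<bar>poly f t\<bar>"
    proof
      assume "1 \<le> C * \<bar>poly f t\<bar>"
      then have "of_int b ^ 4 \<le> c" unfolding ft using b1 by (simp add: le_divide_eq)
      moreover have "real_of_int b \<le> of_int b ^ 4" using b1 by (rule self_le_power) simp
      ultimately have "real_of_int b \<le> c" by (rule order_trans[rotated])
      then have "b \<le> \<lceil>c\<rceil>" by linarith
      then show False using notin ab by auto
    qed
    then obtain \<theta> where "poly f \<theta> = 0" "\<bar>\<theta> - t\<bar> \<le> c / of_int b ^ 4" using near[OF t] ft by auto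
    then show "(a, b) \<in> (\<Union>\<theta>\<in>{\<theta>. poly f \<theta> = 0}. approximations \<theta> c)"
      using ab by (auto simp: approximations_def t_def)
  qed
  have "finite ((\<Union>\<theta>\<in>{\<theta>. poly f \<theta> = 0}. approximations \<theta> c) \<union> {- \<lceil>c\<rceil>..\<lceil>c\<rceil>} \<times> {0..\<lceil>c\<rceil>})"
    using poly_roots_finite[OF f(2)] finite_approximations_quartic[OF f] by auto
  then show ?thesis by (rule rev_finite_subset) (use cover in blast)
qed

lemma finite_thue:
  assumes f: "int_coeffs f" "f \<noteq> 0" "degree f \<le> 4"
    and simple: "\<And>x. poly f x = 0 \<Longrightarrow> poly (pderiv f) x \<noteq> 0"
  shows "finite {(a::int, b::int). coprime a b \<and> \<bar>a\<bar> \<le> \<bar>b\<bar> \<and> of_int b ^ 4 * poly f (of_int a / of_int b) = h}"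
proof -
  define S where "S = {(a::int, b::int). coprime a b \<and> 0 < b \<and> \<bar>a\<bar> \<le> b \<and> of_int b ^ 4 * poly f (of_int a / of_int b) = h}"
  have "finite S" unfolding S_def by (rule finite_thue_positive_denominator[OF assms])
  then have "finite (S \<union> (\<lambda>(a, b). (- a, - b)) ` S)" by simp
  moreover have "(a, b) \<in> S \<union> (\<lambda>(a, b). (- a, - b)) ` S"
    if ab: "coprime a b" "\<bar>a\<bar> \<le> \<bar>b\<bar>" "of_int b ^ 4 * poly f (of_int a / of_int b) = h" for a b :: int
  proof (cases "b > 0")
    case True
    then show ?thesis using ab by (simp add: S_def)
  next
    case False
    moreover have "b \<noteq> 0" using ab by auto
    ultimately have "(- a, - b) \<in> S" using ab by (simp add: S_def)
    then have "(\<lambda>(a, b). (- a, - b)) (- a, - b) \<in> (\<lambda>(a, b). (- a, - b)) ` S" by (rule imageI)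
    then show ?thesis by simp
  qed
  ultimately show ?thesis by (elim rev_finite_subset) blast
qed

section \<open>Parametrization of a conic and the resulting quartic\<close>

definition real_form :: "quad_form \<Rightarrow> real \<Rightarrow> real \<Rightarrow> real" where
  "real_form P x y = of_int (coeff_xx P) * x\<^sup>2 + of_int (coeff_xy P) * x * y + of_int (coeff_yy P) * y\<^sup>2"

definition form_poly :: "quad_form \<Rightarrow> real poly" where
  "form_poly P = [:of_int (coeff_yy P), of_int (coeff_xy P), of_int (coeff_xx P):]"

lemma real_form_of_int: "real_form P (of_int x) (of_int y) = of_int (eval_form P x y)"
  by (simp add: real_form_def eval_form_def)

lemma poly_form_poly: "poly (form_poly P) t = real_form P t 1"
  by (simp add: form_poly_def real_form_def power2_eq_square algebra_simps)

lemma real_form_scale: "real_form P (c * x) (c * y) = c\<^sup>2 * real_form P x y"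
  by (simp add: real_form_def power2_eq_square algebra_simps)

lemma of_int_eval_form_dehomogenize:
  assumes "b \<noteq> 0"
  shows "of_int (eval_form P a b) = of_int b ^ 2 * poly (form_poly P) (of_int a / of_int b)"
  unfolding poly_form_poly real_form_scale[symmetric] using assms by (simp add: real_form_of_int)

lemma no_common_real_zero:
  assumes "Res f g \<noteq> 0" "real_form f x y = 0" "real_form g x y = 0"
  shows "x = 0 \<and> y = 0"
proof -
  obtain a b c a' b' c' where fg: "f = Quad_Form a b c" "g = Quad_Form a' b' c'" by (metis quad_form.exhaust)
  have R: "of_int (Res f g) = (real_of_int a * of_int c' - of_int a' * of_int c)\<^sup>2
      - (real_of_int a * of_int b' - of_int a' * of_int b) * (of_int b * of_int c' - of_int b' * of_int c)"
    by (simp add: fg Res_eq)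
  have "of_int (Res f g) * x ^ 3 = 0" "of_int (Res f g) * y ^ 3 = 0"
    using resultant_cofactors[where a = "real_of_int a" and b = "of_int b" and c = "of_int c"
        and a' = "of_int a'" and b' = "of_int b'" and c' = "of_int c'" and x = x and y = y] assms(2,3)
    unfolding R by (simp_all add: fg real_form_def del: mult_eq_0_iff)
  then show ?thesis using assms(1) by simp
qed

text \<open>
The second intersection of the conic \<open>P(x, y) = d z\<^sup>2\<close> with the line through its point
\<open>(m, n, z\<^sub>0)\<close> in the direction \<open>(a, b, 0)\<close> has \<open>x\<close>- and \<open>y\<close>-coordinates proportional to
\<open>m P(a, b) - B a\<close> and \<open>n P(a, b) - B b\<close>, where \<open>B\<close> is the value of the polar form of \<open>P\<close> at \<open>(m, n)\<close>
and \<open>(a, b)\<close>. The definitions of \<open>param_x\<close> and \<open>param_y\<close> give these two forms in \<open>a\<close> and \<open>b\<close>.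
\<close>

definition param_x :: "quad_form \<Rightarrow> int \<Rightarrow> int \<Rightarrow> quad_form" where
  "param_x P m n = Quad_Form (- (coeff_xx P * m + coeff_xy P * n)) (- 2 * coeff_yy P * n) (coeff_yy P * m)"

definition param_y :: "quad_form \<Rightarrow> int \<Rightarrow> int \<Rightarrow> quad_form" where
  "param_y P m n = Quad_Form (coeff_xx P * n) (- 2 * coeff_xx P * m) (- (coeff_xy P * m + coeff_yy P * n))"

lemma real_form_param:
  "real_form P (real_form (param_x P m n) x y) (real_form (param_y P m n) x y)
     = of_int (eval_form P m n) * (real_form P x y)\<^sup>2"
  unfolding real_form_def param_x_def param_y_def eval_form_def quad_form.sel
  by (simp add: power2_eq_square algebra_simps)

lemma Res_param: "Res (param_x P m n) (param_y P m n) = Disc P * (eval_form P m n)\<^sup>2"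
  unfolding param_x_def param_y_def Res_eq Disc_def eval_form_def
  by (simp add: power2_eq_square algebra_simps)

text \<open>
If \<open>P(m, n) \<noteq> 0\<close>, the map \<open>(a : b) \<mapsto> (X : Y)\<close> has degree two and ramifies exactly where the conic meets the line
\<open>z = 0\<close>, that is, at the zeros of \<open>P\<close>.
\<close>

lemma jacobian_param:
  fixes P :: quad_form and m n :: int
  defines "X \<equiv> form_poly (param_x P m n)" and "Y \<equiv> form_poly (param_y P m n)"
  shows "poly X s * poly (pderiv Y) s - poly (pderiv X) s * poly Y s
       = - 2 * of_int (eval_form P m n) * poly (form_poly P) s"
  unfolding X_def Y_def form_poly_def param_x_def param_y_def eval_form_def
  by (simp add: pderiv_pCons power2_eq_square algebra_simps)

definition quartic_poly :: "quad_form \<Rightarrow> quad_form \<Rightarrow> int \<Rightarrow> int \<Rightarrow> real poly" where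
  "quartic_poly P\<^sub>1 P\<^sub>2 m n = (let X = form_poly (param_x P\<^sub>1 m n); Y = form_poly (param_y P\<^sub>1 m n) in
     smult (of_int (coeff_xx P\<^sub>2)) (X * X) + smult (of_int (coeff_xy P\<^sub>2)) (X * Y) + smult (of_int (coeff_yy P\<^sub>2)) (Y * Y))"

lemma poly_quartic_poly:
  "poly (quartic_poly P\<^sub>1 P\<^sub>2 m n) t
     = real_form P\<^sub>2 (poly (form_poly (param_x P\<^sub>1 m n)) t) (poly (form_poly (param_y P\<^sub>1 m n)) t)"
  by (simp add: quartic_poly_def Let_def real_form_def power2_eq_square mult.assoc)

text \<open>
At a double root \<open>s\<close> the gradient of \<open>P\<^sub>2\<close> at \<open>(X(s), Y(s))\<close> is orthogonal both to \<open>(X, Y)\<close>, by Euler's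
identity, and to \<open>(X', Y')\<close>. As \<open>X\<close> and \<open>Y\<close> have no common zero and \<open>Disc P\<^sub>2 \<noteq> 0\<close>, the gradient is
not zero, so \<open>X Y' - X' Y\<close> vanishes and \<open>s\<close> is a ramification point of the parametrization. Then \<open>P\<^sub>1\<close> and \<open>P\<^sub>2\<close> both vanish at
\<open>(X(s), Y(s))\<close>, contrary to \<open>Res P\<^sub>1 P\<^sub>2 \<noteq> 0\<close>.
\<close>

lemma quartic_poly_simple_roots:
  assumes "Disc P\<^sub>1 \<noteq> 0" "Disc P\<^sub>2 \<noteq> 0" "Res P\<^sub>1 P\<^sub>2 \<noteq> 0" "eval_form P\<^sub>1 m n \<noteq> 0"
    and root: "poly (quartic_poly P\<^sub>1 P\<^sub>2 m n) s = 0"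
  shows "poly (pderiv (quartic_poly P\<^sub>1 P\<^sub>2 m n)) s \<noteq> 0"
proof
  assume double: "poly (pderiv (quartic_poly P\<^sub>1 P\<^sub>2 m n)) s = 0"
  define X Y where "X = form_poly (param_x P\<^sub>1 m n)" and "Y = form_poly (param_y P\<^sub>1 m n)"
  define x y x' y' where "x = poly X s" and "y = poly Y s" and "x' = poly (pderiv X) s" and "y' = poly (pderiv Y) s"
  define a b c where "a = real_of_int (coeff_xx P\<^sub>2)" and "b = real_of_int (coeff_xy P\<^sub>2)" and "c = real_of_int (coeff_yy P\<^sub>2)"
  have P2: "real_form P\<^sub>2 x y = 0" using root by (simp add: poly_quartic_poly x_def y_def X_def Y_def)
  have P2': "a * x\<^sup>2 + b * x * y + c * y\<^sup>2 = 0" using P2 by (simp add: real_form_def a_def b_def c_def)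
  define p q where "p = 2 * a * x + b * y" and "q = b * x + 2 * c * y"
  have pq: "p * x + q * y = 0" using P2' by (simp add: p_def q_def power2_eq_square algebra_simps)
  have pq': "p * x' + q * y' = 0"
    using double unfolding quartic_poly_def Let_def X_def[symmetric] Y_def[symmetric]
    by (simp add: pderiv_add pderiv_smult pderiv_mult p_def q_def a_def b_def c_def
        x_def y_def x'_def y'_def algebra_simps)
  have nonzero: "x \<noteq> 0 \<or> y \<noteq> 0"
  proof (rule ccontr)
    assume "\<not> (x \<noteq> 0 \<or> y \<noteq> 0)"
    then have "real_form (param_x P\<^sub>1 m n) s 1 = 0" "real_form (param_y P\<^sub>1 m n) s 1 = 0"
      by (simp_all add: x_def y_def X_def Y_def poly_form_poly)
    moreover have "Res (param_x P\<^sub>1 m n) (param_y P\<^sub>1 m n) \<noteq> 0" using assms by (simp add: Res_param)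
    ultimately show False using no_common_real_zero[of "param_x P\<^sub>1 m n" "param_y P\<^sub>1 m n" s 1] by simp
  qed
  have "x * y' - x' * y = 0"
  proof (rule ccontr)
    assume J: "x * y' - x' * y \<noteq> 0"
    have "p * (x * y' - x' * y) = (p * x + q * y) * y' - (p * x' + q * y') * y" by (simp add: algebra_simps)
    then have "p = 0" using J pq pq' by simp
    have "q * (x * y' - x' * y) = (p * x' + q * y') * x - (p * x + q * y) * x'" by (simp add: algebra_simps)
    then have "q = 0" using J pq pq' by simp
    have D: "b\<^sup>2 - 4 * a * c = of_int (Disc P\<^sub>2)" by (simp add: Disc_def a_def b_def c_def)
    have "(b\<^sup>2 - 4 * a * c) * x = b * q - 2 * c * p" "(b\<^sup>2 - 4 * a * c) * y = b * p - 2 * a * q"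
      by (simp_all add: p_def q_def power2_eq_square algebra_simps)
    then have "x = 0" "y = 0" using \<open>p = 0\<close> \<open>q = 0\<close> assms(2) unfolding D by simp_all
    then show False using nonzero by simp
  qed
  then have "poly (form_poly P\<^sub>1) s = 0"
    using jacobian_param[of P\<^sub>1 m n s] assms(4) by (simp add: x_def y_def x'_def y'_def X_def Y_def)
  then have "real_form P\<^sub>1 x y = 0"
    using real_form_param[of P\<^sub>1 m n s 1] by (simp add: x_def y_def X_def Y_def poly_form_poly)
  then show False using no_common_real_zero[OF assms(3) _ P2] nonzero by simp
qed

lemma int_coeffs_form_poly: "int_coeffs (form_poly P)"
  by (simp add: form_poly_def int_coeffs_pCons) (simp add: int_coeffs_def)

lemma finite_quartic_form_values_half:
  assumes "Disc P\<^sub>1 \<noteq> 0" "Disc P\<^sub>2 \<noteq> 0" "Res P\<^sub>1 P\<^sub>2 \<noteq> 0" "eval_form P\<^sub>1 m n \<noteq> 0"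
  shows "finite {(a, b). coprime a b \<and> \<bar>a\<bar> \<le> \<bar>b\<bar> \<and>
    eval_form P\<^sub>2 (eval_form (param_x P\<^sub>1 m n) a b) (eval_form (param_y P\<^sub>1 m n) a b) = h}"
proof -
  define f where "f = quartic_poly P\<^sub>1 P\<^sub>2 m n"
  have simple: "poly (pderiv f) x \<noteq> 0" if "poly f x = 0" for x
    using quartic_poly_simple_roots[OF assms] that by (simp add: f_def)
  have "int_coeffs f" unfolding f_def quartic_poly_def Let_def
    by (intro int_coeffs_add int_coeffs_smult int_coeffs_mult int_coeffs_form_poly) auto
  moreover have "f \<noteq> 0" using simple by auto
  moreover have "degree f \<le> 4"
  proof -
    have d: "degree (form_poly P) \<le> 2" for P by (simp add: form_poly_def)
    have "degree (form_poly P * form_poly Q) \<le> 4" for P Q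
      using degree_mult_le[of "form_poly P" "form_poly Q"] d[of P] d[of Q] by linarith
    then show ?thesis unfolding f_def quartic_poly_def Let_def
      by (intro degree_add_le order_trans[OF degree_smult_le]) auto
  qed
  ultimately have "finite {(a, b). coprime a b \<and> \<bar>a\<bar> \<le> \<bar>b\<bar> \<and> of_int b ^ 4 * poly f (of_int a / of_int b) = of_int h}"
    using simple by (intro finite_thue) auto
  moreover have "of_int b ^ 4 * poly f (of_int a / of_int b)
      = of_int (eval_form P\<^sub>2 (eval_form (param_x P\<^sub>1 m n) a b) (eval_form (param_y P\<^sub>1 m n) a b))"
    if "b \<noteq> 0" for a b
  proof -
    define x y where "x = poly (form_poly (param_x P\<^sub>1 m n)) (of_int a / of_int b)"
      and "y = poly (form_poly (param_y P\<^sub>1 m n)) (of_int a / of_int b)"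
    have "real_of_int b ^ 4 * poly f (of_int a / of_int b) = ((real_of_int b)\<^sup>2)\<^sup>2 * real_form P\<^sub>2 x y"
      by (simp add: f_def poly_quartic_poly x_def y_def)
    also have "\<dots> = real_form P\<^sub>2 ((of_int b)\<^sup>2 * x) ((of_int b)\<^sup>2 * y)" by (rule real_form_scale[symmetric])
    also have "\<dots> = real_form P\<^sub>2 (of_int (eval_form (param_x P\<^sub>1 m n) a b)) (of_int (eval_form (param_y P\<^sub>1 m n) a b))"
      unfolding x_def y_def of_int_eval_form_dehomogenize[OF that] ..
    finally show ?thesis by (simp only: real_form_of_int)
  qed
  then have "of_int b ^ 4 * poly f (of_int a / of_int b) = of_int h"
    if "coprime a b" "\<bar>a\<bar> \<le> \<bar>b\<bar>"
      "eval_form P\<^sub>2 (eval_form (param_x P\<^sub>1 m n) a b) (eval_form (param_y P\<^sub>1 m n) a b) = h" for a b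
    using that by (cases "b = 0") auto
  ultimately show ?thesis
    by (elim rev_finite_subset) blast
qed

text \<open>
Exchanging the two variables reduces the solutions with \<open>\<bar>b\<bar> \<le> \<bar>a\<bar>\<close> to those with \<open>\<bar>a\<bar> \<le> \<bar>b\<bar>\<close>.
\<close>

definition swap_form :: "quad_form \<Rightarrow> quad_form" where
  "swap_form P = Quad_Form (coeff_yy P) (coeff_xy P) (coeff_xx P)"

lemma eval_form_swap: "eval_form (swap_form P) y x = eval_form P x y"
  by (simp add: eval_form_def swap_form_def)

lemma Disc_swap: "Disc (swap_form P) = Disc P"
  by (simp add: Disc_def swap_form_def)

lemma Res_swap: "Res (swap_form P) (swap_form Q) = Res P Q"
  by (cases P; cases Q) (simp add: swap_form_def Res_eq power2_eq_square algebra_simps)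

lemma param_swap:
  "param_x (swap_form P) n m = swap_form (param_y P m n)"
  "param_y (swap_form P) n m = swap_form (param_x P m n)"
  by (simp_all add: param_x_def param_y_def swap_form_def)

lemma finite_quartic_form_values:
  assumes "Disc P\<^sub>1 \<noteq> 0" "Disc P\<^sub>2 \<noteq> 0" "Res P\<^sub>1 P\<^sub>2 \<noteq> 0" "eval_form P\<^sub>1 m n \<noteq> 0"
  shows "finite {(a, b). coprime a b \<and>
    eval_form P\<^sub>2 (eval_form (param_x P\<^sub>1 m n) a b) (eval_form (param_y P\<^sub>1 m n) a b) = h}" (is "finite ?S")
proof -
  define A B where "A = {(a, b). coprime a b \<and> \<bar>a\<bar> \<le> \<bar>b\<bar> \<and>
      eval_form P\<^sub>2 (eval_form (param_x P\<^sub>1 m n) a b) (eval_form (param_y P\<^sub>1 m n) a b) = h}"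
    and "B = {(b, a). coprime b a \<and> \<bar>b\<bar> \<le> \<bar>a\<bar> \<and>
      eval_form (swap_form P\<^sub>2) (eval_form (param_x (swap_form P\<^sub>1) n m) b a) (eval_form (param_y (swap_form P\<^sub>1) n m) b a) = h}"
  have "finite A" unfolding A_def by (rule finite_quartic_form_values_half[OF assms])
  moreover have "finite B" unfolding B_def
    using assms by (intro finite_quartic_form_values_half) (simp_all add: Disc_swap Res_swap eval_form_swap)
  ultimately have "finite (A \<union> prod.swap ` B)" by simp
  moreover have "(a, b) \<in> A \<union> prod.swap ` B" if "(a, b) \<in> ?S" for a b
  proof (cases "\<bar>a\<bar> \<le> \<bar>b\<bar>")
    case True
    then show ?thesis using that by (simp add: A_def)
  next
    case False
    then have "(b, a) \<in> B"
      using that by (simp add: B_def param_swap eval_form_swap coprime_commute)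
    then have "prod.swap (b, a) \<in> prod.swap ` B" by (rule imageI)
    then show ?thesis by simp
  qed
  ultimately show ?thesis by (elim rev_finite_subset) blast
qed

text \<open>
When \<open>f\<close> vanishes, the cofactor identities express \<open>Res f g\<close> times the cubes of the coordinates as a
linear form in the coordinates times \<open>d\<close>. A cube outgrows a linear form.
\<close>

lemma finite_zeros_with_given_value:
  assumes "Res f g \<noteq> 0"
  shows "finite {(m, n). eval_form f m n = 0 \<and> eval_form g m n = d}"
proof -
  obtain \<alpha> \<beta> \<gamma> \<delta> \<alpha>' \<beta>' \<gamma>' \<delta>' :: int where
    cof: "\<And>x y. Res f g * x ^ 3 = (\<alpha> * x + \<beta> * y) * eval_form f x y + (\<gamma> * x + \<delta> * y) * eval_form g x y"
    "\<And>x y. Res f g * y ^ 3 = (\<alpha>' * x + \<beta>' * y) * eval_form f x y + (\<gamma>' * x + \<delta>' * y) * eval_form g x y"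
    by (metis eval_form_cofactors)
  define K where "K = (\<bar>\<gamma>\<bar> + \<bar>\<delta>\<bar> + \<bar>\<gamma>'\<bar> + \<bar>\<delta>'\<bar>) * \<bar>d\<bar>"
  have bound: "\<bar>m\<bar> \<le> K \<and> \<bar>n\<bar> \<le> K" if sol: "eval_form f m n = 0" "eval_form g m n = d" for m n
  proof -
    define s where "s = max \<bar>m\<bar> \<bar>n\<bar>"
    have s0: "s \<ge> 0" by (simp add: s_def)
    have lin: "\<bar>u * m + v * n\<bar> \<le> (\<bar>u\<bar> + \<bar>v\<bar>) * s" for u v
    proof -
      have "\<bar>u * m + v * n\<bar> \<le> \<bar>u\<bar> * \<bar>m\<bar> + \<bar>v\<bar> * \<bar>n\<bar>" using abs_triangle_ineq[of "u * m" "v * n"] by (simp add: abs_mult)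
      also have "\<dots> \<le> \<bar>u\<bar> * s + \<bar>v\<bar> * s" by (intro add_mono mult_left_mono) (auto simp: s_def)
      finally show ?thesis by (simp add: algebra_simps)
    qed
    have cube: "\<bar>w\<bar> ^ 3 \<le> K * s" if "Res f g * w ^ 3 = (u * m + v * n) * d" "\<bar>u\<bar> + \<bar>v\<bar> \<le> \<bar>\<gamma>\<bar> + \<bar>\<delta>\<bar> + \<bar>\<gamma>'\<bar> + \<bar>\<delta>'\<bar>" for w u v
    proof -
      have "1 * \<bar>w\<bar> ^ 3 \<le> \<bar>Res f g\<bar> * \<bar>w\<bar> ^ 3" using assms by (intro mult_right_mono) auto
      also have "\<dots> = \<bar>u * m + v * n\<bar> * \<bar>d\<bar>" using that(1) by (metis abs_mult power_abs)
      also have "\<dots> \<le> (\<bar>u\<bar> + \<bar>v\<bar>) * s * \<bar>d\<bar>" by (intro mult_right_mono lin) auto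
      also have "\<dots> \<le> (\<bar>\<gamma>\<bar> + \<bar>\<delta>\<bar> + \<bar>\<gamma>'\<bar> + \<bar>\<delta>'\<bar>) * s * \<bar>d\<bar>"
        using that(2) s0 by (intro mult_right_mono) auto
      finally show ?thesis by (simp add: K_def mult_ac)
    qed
    have "\<bar>m\<bar> ^ 3 \<le> K * s" by (rule cube[of m \<gamma> \<delta>]) (use cof(1)[of m n] sol in auto)
    moreover have "\<bar>n\<bar> ^ 3 \<le> K * s" by (rule cube[of n \<gamma>' \<delta>']) (use cof(2)[of n m] sol in auto)
    ultimately have "s ^ 3 \<le> K * s" unfolding s_def max_def by auto
    then have "s * s\<^sup>2 \<le> s * K" by (simp add: power3_eq_cube power2_eq_square mult_ac)
    then have "s = 0 \<or> s\<^sup>2 \<le> K" using s0 by (auto simp: mult_le_cancel_left)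
    moreover have "K \<ge> 0" by (simp add: K_def)
    moreover have "s \<le> s\<^sup>2" using s0 by (cases "s = 0") (auto simp: power2_eq_square)
    ultimately have "s \<le> K" by auto
    then show ?thesis by (simp add: s_def)
  qed
  then have "{(m, n). eval_form f m n = 0 \<and> eval_form g m n = d} \<subseteq> {- K..K} \<times> {- K..K}"
    by (force simp: abs_le_iff)
  then show ?thesis by (rule finite_subset) simp
qed

section \<open>Reduction to Thue equations\<close>

lemma coprime_proportional:
  fixes m n x y :: int
  assumes "coprime m n" "x * n = y * m"
  obtains t where "x = t * m" "y = t * n"
proof -
  obtain u v where uv: "u * m + v * n = 1" using assms(1) bezout_int[of m n] by auto
  have "(u * x + v * y) * m = x * (u * m + v * n)" "(u * x + v * y) * n = y * (u * m + v * n)"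
    using assms(2) by (simp_all add: algebra_simps)
  then show thesis using that[of "u * x + v * y"] uv by simp
qed

text \<open>
Every further point \<open>(m, n, z)\<close> of the conic is reached by the parametrization, namely with the
direction of the secant through it and the base point, scaled so that its last coordinate vanishes.
\<close>

lemma eval_param_secant:
  fixes P :: quad_form
  assumes "eval_form P m0 n0 = d * z0\<^sup>2" "eval_form P m n = d * z\<^sup>2"
  defines "a \<equiv> z0 * m - z * m0" and "b \<equiv> z0 * n - z * n0"
    and "\<beta> \<equiv> 2 * coeff_xx P * m0 * m + coeff_xy P * (m0 * n + n0 * m) + 2 * coeff_yy P * n0 * n - 2 * d * z0 * z"
  shows "eval_form (param_x P m0 n0) a b = - (z0\<^sup>2 * \<beta>) * m"
    and "eval_form (param_y P m0 n0) a b = - (z0\<^sup>2 * \<beta>) * n"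
proof -
  obtain A B C where P: "P = Quad_Form A B C" by (rule quad_form.exhaust)
  have h0: "A * m0\<^sup>2 + B * m0 * n0 + C * n0\<^sup>2 = d * z0\<^sup>2" and h: "A * m\<^sup>2 + B * m * n + C * n\<^sup>2 = d * z\<^sup>2"
    using assms(1,2) by (simp_all add: P eval_form_def)
  have Pab: "A * a\<^sup>2 + B * a * b + C * b\<^sup>2 = - (z0 * z) * \<beta>"
  proof -
    have "A * a\<^sup>2 + B * a * b + C * b\<^sup>2 = z0\<^sup>2 * (A * m\<^sup>2 + B * m * n + C * n\<^sup>2)
        + z\<^sup>2 * (A * m0\<^sup>2 + B * m0 * n0 + C * n0\<^sup>2)
        - z0 * z * (2 * A * m0 * m + B * (m0 * n + n0 * m) + 2 * C * n0 * n)"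
      by (simp add: a_def b_def power2_eq_square algebra_simps)
    then show ?thesis unfolding h h0 by (simp add: \<beta>_def P power2_eq_square algebra_simps)
  qed
  have polar: "2 * A * m0 * a + B * (m0 * b + n0 * a) + 2 * C * n0 * b = z0 * \<beta>"
  proof -
    have "2 * A * m0 * a + B * (m0 * b + n0 * a) + 2 * C * n0 * b
        = z0 * (2 * A * m0 * m + B * (m0 * n + n0 * m) + 2 * C * n0 * n)
        - 2 * z * (A * m0\<^sup>2 + B * m0 * n0 + C * n0\<^sup>2)"
      by (simp add: a_def b_def power2_eq_square algebra_simps)
    then show ?thesis unfolding h0 by (simp add: \<beta>_def P power2_eq_square algebra_simps)
  qed
  have "eval_form (param_x P m0 n0) a b = m0 * (A * a\<^sup>2 + B * a * b + C * b\<^sup>2)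
      - (2 * A * m0 * a + B * (m0 * b + n0 * a) + 2 * C * n0 * b) * a"
    by (simp add: eval_form_def param_x_def P power2_eq_square algebra_simps)
  then show "eval_form (param_x P m0 n0) a b = - (z0\<^sup>2 * \<beta>) * m"
    unfolding Pab polar by (simp add: a_def power2_eq_square algebra_simps)
  have "eval_form (param_y P m0 n0) a b = n0 * (A * a\<^sup>2 + B * a * b + C * b\<^sup>2)
      - (2 * A * m0 * a + B * (m0 * b + n0 * a) + 2 * C * n0 * b) * b"
    by (simp add: eval_form_def param_y_def P power2_eq_square algebra_simps)
  then show "eval_form (param_y P m0 n0) a b = - (z0\<^sup>2 * \<beta>) * n"
    unfolding Pab polar by (simp add: b_def power2_eq_square algebra_simps)
qed

lemma eval_form_scale: "eval_form P (c * x) (c * y) = c\<^sup>2 * eval_form P x y"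
  by (simp add: eval_form_def power2_eq_square algebra_simps)

text \<open>
Fix a base solution with \<open>z\<^sub>0 \<noteq> 0\<close>. Any \<open>(m, n)\<close> other than \<open>(m\<^sub>0, n\<^sub>0)\<close> and \<open>(- m\<^sub>0, - n\<^sub>0)\<close> is
determined by the primitive direction \<open>(a', b')\<close> of the secant and the common
factor \<open>t\<close> of \<open>X(a', b')\<close> and \<open>Y(a', b')\<close>. If every solution has \<open>z = 0\<close>,
there is no base point, but then \<open>P\<^sub>1\<close> vanishes at all of them.
\<close>

lemma finite_solutions_fixed_denominator:
  assumes disc: "Disc P\<^sub>1 \<noteq> 0" "Disc P\<^sub>2 \<noteq> 0" and res: "Res P\<^sub>1 P\<^sub>2 \<noteq> 0" and d: "d \<noteq> 0"
  shows "finite {(m, n). coprime m n \<and> eval_form P\<^sub>2 m n = d \<and> (\<exists>z. eval_form P\<^sub>1 m n = d * z\<^sup>2)}"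
    (is "finite ?S")
proof (cases "\<exists>m n z. coprime m n \<and> eval_form P\<^sub>2 m n = d \<and> eval_form P\<^sub>1 m n = d * z\<^sup>2 \<and> z \<noteq> 0")
  case False
  then have "?S \<subseteq> {(m, n). eval_form P\<^sub>1 m n = 0 \<and> eval_form P\<^sub>2 m n = d}" by fastforce
  then show ?thesis using finite_zeros_with_given_value[OF res] by (rule finite_subset)
next
  case True
  then obtain m0 n0 z0 where base: "coprime m0 n0" "eval_form P\<^sub>1 m0 n0 = d * z0\<^sup>2" "z0 \<noteq> 0" by blast
  define X Y where "X = eval_form (param_x P\<^sub>1 m0 n0)" and "Y = eval_form (param_y P\<^sub>1 m0 n0)"
  have P0: "eval_form P\<^sub>1 m0 n0 \<noteq> 0" using base d by simp
  define R where "R = Res (param_x P\<^sub>1 m0 n0) (param_y P\<^sub>1 m0 n0)"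
  have R: "R \<noteq> 0" using disc(1) P0 by (simp add: R_def Res_param)
  define T where "T = (\<Union>t\<in>{t. t dvd R}. {(a, b). coprime a b \<and> eval_form P\<^sub>2 (X a b) (Y a b) = t\<^sup>2 * d})"
  have "finite T" unfolding T_def X_def Y_def
    using R by (intro finite_UN_I finite_quartic_form_values disc res P0) simp
  define U where "U = (\<lambda>((a, b), t). (X a b div t, Y a b div t)) ` (T \<times> {t. t dvd R})"
  have "finite U" unfolding U_def using \<open>finite T\<close> R by simp
  then have fin: "finite (U \<union> {(m0, n0), (- m0, - n0)})" by simp
  have "(m, n) \<in> U \<union> {(m0, n0), (- m0, - n0)}"
    if sol: "coprime m n" "eval_form P\<^sub>2 m n = d" "eval_form P\<^sub>1 m n = d * z\<^sup>2" for m n z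
  proof -
    define a b where "a = z0 * m - z * m0" and "b = z0 * n - z * n0"
    show ?thesis
    proof (cases "a = 0 \<and> b = 0")
      case True
      then have eq: "m0 * z = m * z0" "n0 * z = n * z0" by (simp_all add: a_def b_def mult.commute)
      have "z0 * (m0 * n) = z0 * (n0 * m)" using eq by algebra
      then have "m0 * n = n0 * m" using base(3) by simp
      then obtain t where t: "m0 = t * m" "n0 = t * n" using coprime_proportional[OF sol(1)] by blast
      then have "t dvd 1" using base(1) by (metis coprime_def dvd_triv_left)
      then have "t = 1 \<or> t = - 1" by auto
      then show ?thesis using t by auto
    next
      case False
      define g where "g = gcd a b"
      have g: "g \<noteq> 0" using False by (simp add: g_def)
      obtain a' b' where ab: "a = a' * g" "b = b' * g" "coprime a' b'"
        unfolding g_def using False by (metis gcd_coprime_exists gcd_eq_0_iff)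
      obtain \<kappa> where \<kappa>: "X a b = \<kappa> * m" "Y a b = \<kappa> * n"
        using eval_param_secant[OF base(2) sol(3)] unfolding X_def Y_def a_def b_def by blast
      have scale: "X a b = g\<^sup>2 * X a' b'" "Y a b = g\<^sup>2 * Y a' b'"
        unfolding X_def Y_def ab by (simp_all add: mult.commute[of _ g] eval_form_scale)
      have "g\<^sup>2 * (X a' b' * n) = g\<^sup>2 * (Y a' b' * m)" using \<kappa> scale by (simp add: mult.assoc[symmetric])
      then have "X a' b' * n = Y a' b' * m" using g by simp
      then obtain t where t: "X a' b' = t * m" "Y a' b' = t * n" using coprime_proportional[OF sol(1)] by blast
      have "t dvd R" unfolding R_def
        using t ab(3) by (intro common_divisor_dvd_Res[of a' b']) (simp_all add: X_def Y_def)
      moreover have "eval_form P\<^sub>2 (X a' b') (Y a' b') = t\<^sup>2 * d" unfolding t eval_form_scale sol(2) ..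
      ultimately have "(a', b') \<in> T" using ab(3) by (auto simp: T_def)
      moreover have "t \<noteq> 0" using \<open>t dvd R\<close> R by auto
      then have "(m, n) = (\<lambda>((a, b), t). (X a b div t, Y a b div t)) ((a', b'), t)" using t by simp
      ultimately have "(m, n) \<in> U" unfolding U_def using \<open>t dvd R\<close> by (intro image_eqI) auto
      then show ?thesis by simp
    qed
  qed
  then have "?S \<subseteq> U \<union> {(m0, n0), (- m0, - n0)}" by blast
  then show ?thesis using fin by (rule finite_subset)
qed

theorem theorem4:
  fixes P\<^sub>1 P\<^sub>2 :: quad_form
  assumes "Disc P\<^sub>1 \<noteq> 0" and "Disc P\<^sub>2 \<noteq> 0" and "Res P\<^sub>1 P\<^sub>2 \<noteq> 0"
  shows "finite {(m, n, k).
           gcd m n = 1 \<and> eval_form P\<^sub>2 m n \<noteq> 0 \<and>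
           (of_int k :: rat)\<^sup>2 = of_int (eval_form P\<^sub>1 m n) / of_int (eval_form P\<^sub>2 m n)}"
proof -
  define N where "N = (\<Union>d\<in>{d. d dvd Res P\<^sub>1 P\<^sub>2 \<and> d \<noteq> 0}.
    {(m, n). coprime m n \<and> eval_form P\<^sub>2 m n = d \<and> (\<exists>z. eval_form P\<^sub>1 m n = d * z\<^sup>2)})"
  have "finite N" unfolding N_def
  proof (rule finite_UN_I)
    show "finite {d. d dvd Res P\<^sub>1 P\<^sub>2 \<and> d \<noteq> 0}"
      using finite_divisors_int[OF assms(3)] by (rule rev_finite_subset) auto
  qed (use finite_solutions_fixed_denominator[OF assms] in simp)
  define V where "V = (\<Union>(m, n)\<in>N. {m} \<times> {n} \<times> {- \<bar>eval_form P\<^sub>1 m n\<bar>..\<bar>eval_form P\<^sub>1 m n\<bar>})"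
  have "finite V" unfolding V_def using \<open>finite N\<close> by auto
  moreover have "(m, n, k) \<in> V"
    if mn: "coprime m n" "eval_form P\<^sub>2 m n \<noteq> 0"
      and k: "(of_int k :: rat)\<^sup>2 = of_int (eval_form P\<^sub>1 m n) / of_int (eval_form P\<^sub>2 m n)" for m n k
  proof -
    have "(of_int (eval_form P\<^sub>1 m n) :: rat) = of_int (eval_form P\<^sub>2 m n * k\<^sup>2)"
      using mn(2) k by (simp add: field_simps)
    then have eq: "eval_form P\<^sub>1 m n = eval_form P\<^sub>2 m n * k\<^sup>2" by (simp only: of_int_eq_iff)
    have "eval_form P\<^sub>2 m n dvd Res P\<^sub>1 P\<^sub>2"
      using mn(1) by (rule common_divisor_dvd_Res) (simp_all add: eq)
    then have N: "(m, n) \<in> N" using mn eq by (auto simp: N_def)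
    have "\<bar>k\<bar> \<le> 1 * k\<^sup>2" using self_le_power[of "\<bar>k\<bar>" 2] by (cases "k = 0") auto
    also have "\<dots> \<le> \<bar>eval_form P\<^sub>2 m n\<bar> * k\<^sup>2" using mn(2) by (intro mult_right_mono) auto
    also have "\<dots> = \<bar>eval_form P\<^sub>1 m n\<bar>" by (simp add: eq abs_mult)
    finally show ?thesis using N by (force simp: V_def abs_le_iff)
  qed
  ultimately show ?thesis by (elim rev_finite_subset, intro subsetI, clarify) blast
qed

end
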